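(* For each $1<p<\infty$ there exists a positive constant $c_p$, depending only on $p$, such that the following holds. Let $(d_k)_{k\ge1}$, $(e_k)_{k\ge1}$ be real-valued martingale difference sequences on $[0,1]^{\mathbb{N}}$ with respect to $(\mathcal{L}_k)_{k\ge0}$. Suppose that for each positive integer $k$, $$\int_0^t (e_k(x_1,\dots,x_{k-1},\cdot))^{\#}(s)\,ds\le \int_0^t (d_k(x_1,\dots,x_{k-1},\cdot))^{\#}(s)\,ds$$ for all $t\in[0,1]$ and almost all $x_1,\dots,x_{k-1}$. Then for all positive integers $n$, $$\left\|\sum_{k=1}^n e_k\right\|_p\le c_p\left\|\sum_{k=1}^n d_k\right\|_p .$$
   Context: The probability space is $[0,1]^{\mathbb{N}}$ with the product Lebesgue measure. $\mathcal{L}_k$ is the minimal $\sigma$-field for which the first $k$ coordinate functions $x_1,\dots,x_k$ are measurable ($\mathcal{L}_0$ is trivial). An $\mathcal{L}_k$-measurable random variable is regarded as a function of $(x_1,\dots,x_k)$. $(d_k)_{k\ge1}$ is a martingale difference sequence with respect to $(\mathcal{L}_k)$ if each $d_k$ is integrable and $\mathcal{L}_k$-measurable and $E[d_k\mid\mathcal{L}_{k-1}]=0$ for all $k\ge1$. For a random variable $f$ on a probability space, $f^{\#}$ denotes the decreasing rearrangement of $|f|$: $f^{\#}(t)=\inf\{s\ge0: P(|f|>s)\le t\}$ for $t\in(0,1)$; here it is applied to $d_k(x_1,\dots,x_{k-1},\cdot)$ and $e_k(x_1,\dots,x_{k-1},\cdot)$ as random variables on $[0,1]$ with Lebesgue measure.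 $\|X\|_p=(E|X|^p)^{1/p}$, which may be $+\infty$. *)

theory Defs
  imports "HOL-Probability.Probability"
begin

definition unit_measure :: "real measure" where
  "unit_measure = restrict_space lborel {0..1}"

text \<open>The coordinates are indexed by the positive integers; elements of the space are
  \<open>undefined\<close> at index \<open>0\<close>.\<close>

definition cube :: "(nat \<Rightarrow> real) measure" where
  "cube = PiM {1..} (\<lambda>_. unit_measure)"

definition coord_algebra :: "nat \<Rightarrow> (nat \<Rightarrow> real) measure" where
  "coord_algebra k = sigma (space cube)
     (\<Union>i\<in>{1..k}. {(\<lambda>x. x i) -` A \<inter> space cube | A. A \<in> sets unit_measure})"

text \<open>Only the values of the sequence at positive indices matter.\<close>

definition martingale_difference_seq ::
    "'a measure \<Rightarrow> (nat \<Rightarrow> 'a measure) \<Rightarrow> (nat \<Rightarrow> 'a \<Rightarrow> real) \<Rightarrow> bool" where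
  "martingale_difference_seq M F d \<longleftrightarrow>
     (\<forall>k\<ge>1. integrable M (d k) \<and> d k \<in> borel_measurable (F k) \<and>
            (AE x in M. real_cond_exp M (F (k - 1)) (d k) x = 0))"

text \<open>Meaningful for \<open>0 < t < 1\<close>, where the infimum is over a nonempty set if \<open>f\<close> is a
  random variable on the probability space \<open>M\<close>.\<close>

definition decr_rearrangement :: "'a measure \<Rightarrow> ('a \<Rightarrow> real) \<Rightarrow> real \<Rightarrow> real" where
  "decr_rearrangement M f t = Inf {s. 0 \<le> s \<and> measure M {x \<in> space M. \<bar>f x\<bar> > s} \<le> t}"

text \<open>The section \<open>f(x\<^sub>1, \<dots>, x\<^sub>k\<^sub>-\<^sub>1, \<cdot>)\<close>. If \<open>f\<close> is measurable
  with respect to \<^term>\<open>coord_algebra k\<close>, the coordinates of \<open>x\<close> from index \<open>k\<close> on are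
  irrelevant.\<close>

definition coord_section :: "nat \<Rightarrow> ((nat \<Rightarrow> real) \<Rightarrow> real) \<Rightarrow> (nat \<Rightarrow> real) \<Rightarrow> real \<Rightarrow> real" where
  "coord_section k f x = (\<lambda>u. f (x(k := u)))"

definition Lp_norm :: "real \<Rightarrow> 'a measure \<Rightarrow> ('a \<Rightarrow> real) \<Rightarrow> ennreal" where
  "Lp_norm p M f = (let I = (\<integral>\<^sup>+ x. ennreal (\<bar>f x\<bar> powr p) \<partial>M)
     in if I = \<infinity> then \<infinity> else ennreal (enn2real I powr (1 / p)))"

lemma space_unit_measure: "space unit_measure = {0..1}"
  by (simp add: unit_measure_def space_restrict_space)

lemma prob_space_unit_measure: "prob_space unit_measure"
  by (rule prob_spaceI) (simp add: unit_measure_def emeasure_restrict_space space_restrict_space)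

lemma prob_space_cube: "prob_space cube"
  unfolding cube_def by (intro prob_space_PiM prob_space_unit_measure)

text \<open>This makes \<^const>\<open>real_cond_exp\<close> given \<^term>\<open>coord_algebra k\<close> the conditional
  expectation, by \<open>finite_measure_subalgebra_is_sigma_finite\<close>.\<close>

lemma subalgebra_coord_algebra: "subalgebra cube (coord_algebra k)"
proof -
  have "(\<lambda>x. x i) -` A \<inter> space cube \<in> sets cube" if "i \<in> {1..k}" "A \<in> sets unit_measure" for i A
    using that unfolding cube_def by (intro measurable_sets[OF measurable_component_singleton]) auto
  then have "sets (coord_algebra k) \<subseteq> sets cube"
    unfolding coord_algebra_def
    by (subst sets_measure_of) (auto intro!: sets.sigma_sets_subset)
  then show ?thesis
    by (simp add: subalgebra_def coord_algebra_def space_measure_of_conv)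
qed

end

theory Submission
  imports Defs
begin

text \<open>
  Put \<open>G(a, b) = (a + b)\<^sup>p\<^sup>-\<^sup>2 b\<^sup>2\<close>. The second-order remainder
  \<open>\<bar>z + w\<bar>\<^sup>p - \<bar>z\<bar>\<^sup>p - p \<bar>z\<bar>\<^sup>p\<^sup>-\<^sup>2 \<langle>z, w\<rangle>\<close> in a Euclidean space is comparable to
  \<open>G(\<bar>z\<bar>, \<bar>w\<bar>)\<close>, and its linear term vanishes in expectation along a martingale. The majorization
  hypothesis says that the conditional expectation of \<open>(\<bar>e\<^sub>k\<bar> - a)\<^sup>+\<close> is at most that of
  \<open>(\<bar>d\<^sub>k\<bar> - a)\<^sup>+\<close> for every \<open>a \<ge> 0\<close>. As \<open>G(A, \<sqdot>)\<close> is comparable to a mixture of these hinge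
  functions, \<open>E G(V, \<bar>e\<^sub>k\<bar>) \<le> C E G(V, \<bar>d\<^sub>k\<bar>)\<close> for every \<open>V \<ge> 0\<close> depending on the first \<open>k - 1\<close>
  coordinates only. Let \<open>X\<close> and \<open>Y\<close> be the partial sums of \<open>d\<close> and \<open>e\<close>.

  If \<open>p \<le> 2\<close>, then \<open>G\<close> decreases in its first argument, so the increments of \<open>E \<bar>(X, Y)\<bar>\<^sup>p\<close> are
  bounded by those of a multiple of \<open>E \<bar>X\<bar>\<^sup>p\<close>. If \<open>p \<ge> 2\<close>, then \<open>G\<close> increases in its first argument,
  so the increments of \<open>c\<^sup>2 E \<bar>Y\<bar>\<^sup>p\<close> are bounded by those of a multiple (independent of \<open>c \<ge> 1\<close>) of
  \<open>E \<bar>(c X, Y)\<bar>\<^sup>p\<close>; for large \<open>c\<close> the contribution of \<open>Y\<close> to the right-hand side is absorbed on the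
  left.
\<close>

section \<open>Second-order remainders of powers of norms\<close>

definition mixed_power :: "real \<Rightarrow> real \<Rightarrow> real \<Rightarrow> real" where
  "mixed_power p a b = (a + b) powr (p - 2) * b\<^sup>2"

text \<open>This is the Bregman divergence of the p-th power of the norm between
  \<open>z + w\<close> and \<open>z\<close>: for \<open>1 < p\<close> the gradient of that power at
  \<open>z\<close> is \<open>p * norm z powr (p - 2)\<close> times \<open>z\<close>, and it vanishes
  at \<open>z = 0\<close>.\<close>

definition bregman :: "real \<Rightarrow> 'a::real_inner \<Rightarrow> 'a \<Rightarrow> real" where
  "bregman p z w = norm (z + w) powr p - norm z powr p - p * norm z powr (p - 2) * inner z w"

section \<open>The remainder on the real line\<close>

lemma abs_powr_minus_two_mult: "\<bar>x::real\<bar> powr (p - 2) * x = sgn x * \<bar>x\<bar> powr (p - 1)"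
proof (cases "x = 0")
  case False
  then have "\<bar>x\<bar> powr (p - 1) = \<bar>x\<bar> powr (p - 2) * \<bar>x\<bar>"
    using powr_add[of "\<bar>x\<bar>" "p - 2" 1] by simp
  moreover have "sgn x * \<bar>x\<bar> = x" by (rule sgn_mult_abs)
  ultimately show ?thesis by (simp add: mult.left_commute)
qed simp

lemma powr_mult_sq: "a powr (p - 2) * a\<^sup>2 = a powr p" if "0 \<le> a" for a p :: real
proof (cases "a = 0")
  case False
  with that have "a > 0" by simp
  then have "a\<^sup>2 = a powr 2" by (simp add: powr_numeral)
  then show ?thesis by (simp flip: powr_add)
qed auto

text \<open>Away from 0 this is the chain rule. At 0 the difference quotient has absolute value
  \<open>|h| powr (p - 1)\<close>, which tends to 0 because \<open>1 < p\<close>.\<close>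

lemma has_real_derivative_abs_powr:
  fixes p :: real
  assumes "1 < p"
  shows "((\<lambda>x. \<bar>x\<bar> powr p) has_real_derivative p * \<bar>x\<bar> powr (p - 2) * x) (at x)"
proof (cases "x = 0")
  case True
  have "((\<lambda>h::real. \<bar>h\<bar> powr (p - 1)) \<longlongrightarrow> 0) (at 0)"
    using assms by (intro tendsto_zero_powrI[where b = "p - 1"] tendsto_rabs_zero tendsto_ident_at tendsto_const) simp_all
  moreover have "norm ((\<bar>0 + h\<bar> powr p - \<bar>0\<bar> powr p) / h) \<le> \<bar>h\<bar> powr (p - 1)" if "h \<noteq> 0" for h :: real
    using that by (simp add: powr_diff)
  then have "\<forall>\<^sub>F h in at 0. norm ((\<bar>0 + h\<bar> powr p - \<bar>0\<bar> powr p) / h) \<le> \<bar>h\<bar> powr (p - 1)"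
    unfolding eventually_at_filter by (intro always_eventually) blast
  ultimately have "((\<lambda>h::real. (\<bar>0 + h\<bar> powr p - \<bar>0\<bar> powr p) / h) \<longlongrightarrow> 0) (at 0)"
    by (rule Lim_null_comparison[rotated])
  then show ?thesis
    using True by (simp add: DERIV_def)
next
  case False
  have *: "\<bar>x\<bar> powr (p - 2) * x = \<bar>x\<bar> powr (p - 1) * sgn x"
    unfolding abs_powr_minus_two_mult by (rule mult.commute)
  have "abs = (norm :: real \<Rightarrow> real)" "(*) (sgn x) = (\<lambda>h. inner h (sgn x))" by (auto simp: fun_eq_iff)
  then have "((\<lambda>x. \<bar>x\<bar>) has_real_derivative sgn x) (at x)"
    using has_derivative_norm[OF False] by (simp only: has_field_derivative_def)
  then have "((\<lambda>x. \<bar>x\<bar> powr p) has_real_derivative (p * \<bar>x\<bar> powr (p - 1)) * sgn x) (at x)"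
    using False by (intro DERIV_chain2[OF has_real_derivative_powr]) simp_all
  then show ?thesis by (simp only: mult.assoc *)
qed

text \<open>By the mean value theorem the difference is \<open>b - a\<close> times
  \<open>(p - 1) * z powr (p - 2)\<close> for some \<open>z\<close> in between. The exponent
  \<open>p - 2\<close> is not positive, so this factor is at least its value at
  \<open>r\<close>.\<close>

lemma powr_diff_ge:
  fixes p :: real
  assumes "1 < p" "p \<le> 2" "0 \<le> a" "a \<le> b" "b \<le> r"
  shows "(p - 1) * r powr (p - 2) * (b - a) \<le> b powr (p - 1) - a powr (p - 1)"
proof (cases "a = b")
  case False
  then have "a < b" using assms by simp
  have "\<exists>l z. a < z \<and> z < b \<and> DERIV (\<lambda>x. x powr (p - 1)) z :> l
      \<and> b powr (p - 1) - a powr (p - 1) = (b - a) * l"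
  proof (rule MVT)
    show "continuous_on {a..b} (\<lambda>x. x powr (p - 1))"
      using assms by (intro continuous_on_powr' continuous_intros) auto
    show "(\<lambda>x. x powr (p - 1)) differentiable at x" if "a < x" "x < b" for x
      using has_real_derivative_powr[of x "p - 1"] that assms by (auto simp: real_differentiable_def)
  qed fact
  then obtain l z where z: "a < z" "z < b" "DERIV (\<lambda>x. x powr (p - 1)) z :> l"
    and eq: "b powr (p - 1) - a powr (p - 1) = (b - a) * l" by blast
  have "z > 0" using z assms by simp
  from has_real_derivative_powr[OF this, of "p - 1"] z(3)
  have "l = (p - 1) * z powr (p - 1 - 1)" by (rule DERIV_unique[symmetric])
  moreover have "r powr (p - 2) \<le> z powr (p - 2)"
    using z assms \<open>z > 0\<close> by (intro powr_mono2') auto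
  ultimately have "(p - 1) * r powr (p - 2) \<le> l"
    using assms by simp
  with eq \<open>a < b\<close> show ?thesis by (simp add: mult.commute)
qed simp

lemma powr_diff_le:
  fixes p :: real
  assumes "2 \<le> p" "0 \<le> a" "a \<le> b" "b \<le> r"
  shows "b powr (p - 1) - a powr (p - 1) \<le> (p - 1) * r powr (p - 2) * (b - a)"
proof (cases "a = b")
  case False
  then have "a < b" using assms by simp
  have "\<exists>l z. a < z \<and> z < b \<and> DERIV (\<lambda>x. x powr (p - 1)) z :> l
      \<and> b powr (p - 1) - a powr (p - 1) = (b - a) * l"
  proof (rule MVT)
    show "continuous_on {a..b} (\<lambda>x. x powr (p - 1))"
      using assms by (intro continuous_on_powr' continuous_intros) auto
    show "(\<lambda>x. x powr (p - 1)) differentiable at x" if "a < x" "x < b" for x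
      using has_real_derivative_powr[of x "p - 1"] that assms by (auto simp: real_differentiable_def)
  qed fact
  then obtain l z where z: "a < z" "z < b" "DERIV (\<lambda>x. x powr (p - 1)) z :> l"
    and eq: "b powr (p - 1) - a powr (p - 1) = (b - a) * l" by blast
  have "z > 0" using z assms by simp
  from has_real_derivative_powr[OF this, of "p - 1"] z(3)
  have "l = (p - 1) * z powr (p - 1 - 1)" by (rule DERIV_unique[symmetric])
  moreover have "z powr (p - 2) \<le> r powr (p - 2)"
    using z assms \<open>z > 0\<close> by (intro powr_mono2) auto
  ultimately have "l \<le> (p - 1) * r powr (p - 2)"
    using assms by simp
  with eq \<open>a < b\<close> show ?thesis by (simp add: mult.commute)
qed simp

text \<open>Arguments of one sign reduce to \<open>powr_diff_ge\<close> because the signed power is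
  odd; an interval around 0 is split at 0. Multiplied by \<open>p\<close>, the inequality says that
  \<open>|x| powr p\<close> minus a suitable parabola has an increasing derivative on
  \<open>[-r, r]\<close>.\<close>

lemma sgn_powr_diff_ge:
  fixes p :: real
  assumes p: "1 < p" "p \<le> 2" and xy: "-r \<le> x" "x \<le> y" "y \<le> r"
  shows "(p - 1) * r powr (p - 2) * (y - x) \<le> sgn y * \<bar>y\<bar> powr (p - 1) - sgn x * \<bar>x\<bar> powr (p - 1)"
proof -
  consider "0 \<le> x" | "y \<le> 0" | "x < 0" "0 < y" by linarith
  then show ?thesis
  proof cases
    case 1
    then show ?thesis using powr_diff_ge[OF p, of x y r] xy
      by (cases "x = 0"; cases "y = 0") auto
  next
    case 2
    then show ?thesis using powr_diff_ge[OF p, of "-y" "-x" r] xy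
      by (cases "x = 0"; cases "y = 0") auto
  next
    case 3
    then show ?thesis using powr_diff_ge[OF p, of 0 y r] powr_diff_ge[OF p, of 0 "-x" r] xy p
      by (simp add: right_diff_distrib)
  qed
qed

lemma sgn_powr_diff_le:
  fixes p :: real
  assumes p: "2 \<le> p" and xy: "-r \<le> x" "x \<le> y" "y \<le> r"
  shows "sgn y * \<bar>y\<bar> powr (p - 1) - sgn x * \<bar>x\<bar> powr (p - 1) \<le> (p - 1) * r powr (p - 2) * (y - x)"
proof -
  consider "0 \<le> x" | "y \<le> 0" | "x < 0" "0 < y" by linarith
  then show ?thesis
  proof cases
    case 1
    then show ?thesis using powr_diff_le[OF p, of x y r] xy
      by (cases "x = 0"; cases "y = 0") auto
  next
    case 2
    then show ?thesis using powr_diff_le[OF p, of "-y" "-x" r] xy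
      by (cases "x = 0"; cases "y = 0") auto
  next
    case 3
    then show ?thesis using powr_diff_le[OF p, of 0 y r] powr_diff_le[OF p, of 0 "-x" r] xy p
      by (simp add: right_diff_distrib)
  qed
qed

text \<open>The interval \<open>[-r, r]\<close> contains \<open>x\<close> and \<open>x + d\<close>,
  and \<open>g\<close> is convex there. The mean value theorem supplies a point \<open>z\<close>
  between them, and \<open>g' z - g' x\<close> is 0 or has the sign of \<open>d\<close>.\<close>

lemma tangent_line_le:
  fixes g :: "real \<Rightarrow> real"
  assumes der: "\<And>x. (g has_real_derivative g' x) (at x)"
    and mono: "\<And>x y. -r \<le> x \<Longrightarrow> x \<le> y \<Longrightarrow> y \<le> r \<Longrightarrow> g' x \<le> g' y"
    and bound: "\<bar>x\<bar> + \<bar>d\<bar> \<le> r"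
  shows "g x + g' x * d \<le> g (x + d)"
proof -
  have "\<exists>z. g (x + d) = g x + g' z * d \<and> g' x * d \<le> g' z * d"
  proof -
    consider "d = 0" | "d > 0" | "d < 0" by linarith
    then show ?thesis
    proof cases
      case 2
      then obtain z where z: "x < z" "z < x + d" "g (x + d) - g x = (x + d - x) * g' z"
        using MVT2[of x "x + d" g g'] der by auto
      moreover have "g' x * d \<le> g' z * d"
        using z bound 2 by (intro mult_right_mono mono) auto
      ultimately show ?thesis by (intro exI[of _ z]) (simp add: algebra_simps)
    next
      case 3
      then obtain z where z: "x + d < z" "z < x" "g x - g (x + d) = (x - (x + d)) * g' z"
        using MVT2[of "x + d" x g g'] der by auto
      moreover have "g' x * d \<le> g' z * d"
        using z bound 3 by (intro mult_right_mono_neg mono) auto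
      ultimately show ?thesis by (intro exI[of _ z]) (simp add: algebra_simps)
    qed simp
  qed
  then show ?thesis by auto
qed

text \<open>On \<open>[-r, r]\<close> without 0 the second derivative of \<open>|x| powr p\<close>
  is at least \<open>m\<close>, its value at the ends. Subtracting the parabola with second
  derivative \<open>m\<close> leaves a convex function, whose tangent inequality at \<open>x\<close>
  is the claim.\<close>

lemma bregman_real_ge:
  fixes x d p :: real
  assumes p: "1 < p" "p \<le> 2"
  shows "p * (p - 1) / 2 * mixed_power p \<bar>x\<bar> \<bar>d\<bar> \<le> bregman p x d"
proof -
  define r where "r = \<bar>x\<bar> + \<bar>d\<bar>"
  define m where "m = p * (p - 1) * r powr (p - 2)"
  define g where "g x = \<bar>x\<bar> powr p - m / 2 * x\<^sup>2" for x
  define g' where "g' x = p * \<bar>x\<bar> powr (p - 2) * x - m * x" for x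
  have "(g has_real_derivative g' x) (at x)" for x
    unfolding g_def g'_def by (rule derivative_eq_intros has_real_derivative_abs_powr p | simp)+
  moreover have "g' x \<le> g' y" if "-r \<le> x" "x \<le> y" "y \<le> r" for x y
  proof -
    have "p * ((p - 1) * r powr (p - 2) * (y - x)) \<le> p * (sgn y * \<bar>y\<bar> powr (p - 1) - sgn x * \<bar>x\<bar> powr (p - 1))"
      using p by (intro mult_left_mono sgn_powr_diff_ge that) auto
    then show ?thesis
      unfolding g'_def m_def mult.assoc abs_powr_minus_two_mult by (simp add: algebra_simps)
  qed
  ultimately have "g x + g' x * d \<le> g (x + d)"
    by (rule tangent_line_le[where r = r]) (auto simp: r_def)
  then have "m / 2 * d\<^sup>2 \<le> bregman p x d"
    unfolding g_def g'_def bregman_def by (simp add: algebra_simps power2_eq_square)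
  then show ?thesis
    by (simp add: m_def r_def mixed_power_def mult_ac)
qed

text \<open>For \<open>2 \<le> p\<close> the value \<open>m\<close> at the ends is the maximum of
  the second derivative, so now the parabola minus the power is convex on
  \<open>[-r, r]\<close>.\<close>

lemma bregman_real_le:
  fixes x d p :: real
  assumes p: "2 \<le> p"
  shows "bregman p x d \<le> p * (p - 1) / 2 * mixed_power p \<bar>x\<bar> \<bar>d\<bar>"
proof -
  define r where "r = \<bar>x\<bar> + \<bar>d\<bar>"
  define m where "m = p * (p - 1) * r powr (p - 2)"
  define g where "g x = m / 2 * x\<^sup>2 - \<bar>x\<bar> powr p" for x
  define g' where "g' x = m * x - p * \<bar>x\<bar> powr (p - 2) * x" for x
  have p1: "1 < p" using p by simp
  have "(g has_real_derivative g' x) (at x)" for x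
    unfolding g_def g'_def by (rule derivative_eq_intros has_real_derivative_abs_powr p1 | simp)+
  moreover have "g' x \<le> g' y" if "-r \<le> x" "x \<le> y" "y \<le> r" for x y
  proof -
    have "p * (sgn y * \<bar>y\<bar> powr (p - 1) - sgn x * \<bar>x\<bar> powr (p - 1)) \<le> p * ((p - 1) * r powr (p - 2) * (y - x))"
      using p by (intro mult_left_mono sgn_powr_diff_le that) auto
    then show ?thesis
      unfolding g'_def m_def mult.assoc abs_powr_minus_two_mult by (simp add: algebra_simps)
  qed
  ultimately have "g x + g' x * d \<le> g (x + d)"
    by (rule tangent_line_le[where r = r]) (auto simp: r_def)
  then have "bregman p x d \<le> m / 2 * d\<^sup>2"
    unfolding g_def g'_def bregman_def by (simp add: algebra_simps power2_eq_square)
  then show ?thesis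
    by (simp add: m_def r_def mixed_power_def mult_ac)
qed

text \<open>A concave power lies below its tangent. For \<open>t > 0\<close> this is Young's
  inequality \<open>t powr q * s powr (1 - q) \<le> q * t + (1 - q) * s\<close> multiplied by
  \<open>s powr (q - 1)\<close>.\<close>

lemma powr_le_tangent:
  fixes s t q :: real
  assumes "0 < q" "q \<le> 1" "0 < s" "0 \<le> t"
  shows "t powr q \<le> s powr q + q * s powr (q - 1) * (t - s)"
proof -
  have s: "s powr q = s powr (q - 1) * s" using assms by (simp add: powr_diff)
  show ?thesis
  proof (cases "t = 0")
    case True
    have "q * (s powr (q - 1) * s) \<le> 1 * (s powr (q - 1) * s)"
      using assms by (intro mult_right_mono) auto
    then show ?thesis using True assms unfolding s by (simp add: algebra_simps)
  next
    case False
    then have "t powr q * s powr (1 - q) \<le> q * t + (1 - q) * s"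
      using assms by (intro Youngs_inequality_0) auto
    then have "s powr (q - 1) * (t powr q * s powr (1 - q)) \<le> s powr (q - 1) * (q * t + (1 - q) * s)"
      by (intro mult_left_mono) auto
    moreover have "s powr (q - 1) * (t powr q * s powr (1 - q)) = t powr q"
    proof -
      have "s powr (q - 1) * s powr (1 - q) = 1" using assms by (simp flip: powr_add)
      then show ?thesis by (subst mult.left_commute) simp
    qed
    ultimately have "t powr q \<le> s powr (q - 1) * (q * t + (1 - q) * s)" by simp
    then show ?thesis unfolding s by (simp add: algebra_simps)
  qed
qed

lemma powr_ge_tangent:
  fixes s t q :: real
  assumes "1 \<le> q" "0 < s" "0 \<le> t"
  shows "s powr q + q * s powr (q - 1) * (t - s) \<le> t powr q"
proof (cases "t = 0")
  case True
  have s: "s powr q = s powr (q - 1) * s" using assms by (simp add: powr_diff)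
  have "1 * (s powr (q - 1) * s) \<le> q * (s powr (q - 1) * s)"
    using assms by (intro mult_right_mono) auto
  then show ?thesis using True assms unfolding s by (simp add: algebra_simps)
next
  case False
  have "t powr q - s powr q \<ge> q * s powr (q - 1) * (t - s)"
  proof (rule convex_on_imp_above_tangent[where A = "{0<..}" and f = "\<lambda>x. x powr q"])
    show "((\<lambda>x. x powr q) has_real_derivative q * s powr (q - 1)) (at s within {0<..})"
      by (rule has_field_derivative_at_within[OF has_real_derivative_powr[OF assms(2)]])
    show "s \<in> interior {0<..}" using assms by (simp add: interior_open)
    show "convex_on {0<..} (\<lambda>x. x powr q)" using assms(1) by (rule powr_convex)
    show "connected {0::real<..}" by (rule connected_Ioi)
    show "t \<in> {0<..}" using assms False by simp
  qed
  then show ?thesis by simp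
qed

section \<open>The remainder in an inner product space\<close>

lemma norm_powr_eq: "norm z powr r = ((norm z)\<^sup>2) powr (r / 2)"
proof (cases "z = 0")
  case False
  then have "(norm z)\<^sup>2 = norm z powr 2" by (simp add: powr_numeral)
  then show ?thesis by (simp only: powr_powr) simp
qed simp

lemma norm_plus_sq: "(norm (z + w))\<^sup>2 = (norm z)\<^sup>2 + 2 * inner z w + (norm w)\<^sup>2"
  by (simp add: power2_norm_eq_inner inner_add inner_commute)

text \<open>As a function of the squared norm \<open>s\<close>, the p-th power of the norm is
  \<open>s powr (p / 2)\<close>, which is concave here. The squared norm grows by
  \<open>2 * inner z w + (norm w)^2\<close>, and the first summand turns the tangent inequality's
  first-order term into the linear term of \<open>bregman\<close>.\<close>

lemma bregman_le_sq:
  assumes "0 < p" "p \<le> 2" "z \<noteq> 0"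
  shows "bregman p z w \<le> p / 2 * norm z powr (p - 2) * (norm w)\<^sup>2"
proof -
  define s where "s = (norm z)\<^sup>2"
  have "s > 0" using assms by (simp add: s_def)
  have "((norm (z + w))\<^sup>2) powr (p / 2) \<le> s powr (p / 2) + p / 2 * s powr (p / 2 - 1) * ((norm (z + w))\<^sup>2 - s)"
    using assms \<open>s > 0\<close> by (intro powr_le_tangent) auto
  moreover have "s powr (p / 2 - 1) = norm z powr (p - 2)"
    unfolding norm_powr_eq[of z "p - 2"] s_def by (simp add: diff_divide_distrib)
  moreover have "(norm (z + w))\<^sup>2 - s = 2 * inner z w + (norm w)\<^sup>2"
    by (simp add: norm_plus_sq s_def)
  ultimately have "norm (z + w) powr p
      \<le> norm z powr p + p / 2 * norm z powr (p - 2) * (2 * inner z w + (norm w)\<^sup>2)"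
    unfolding norm_powr_eq[of "z + w" p] norm_powr_eq[of z p] s_def by simp
  then show ?thesis unfolding bregman_def by (simp add: field_simps)
qed

lemma bregman_ge_sq:
  assumes "2 \<le> p" "z \<noteq> 0"
  shows "p / 2 * norm z powr (p - 2) * (norm w)\<^sup>2 \<le> bregman p z w"
proof -
  define s where "s = (norm z)\<^sup>2"
  have "s > 0" using assms by (simp add: s_def)
  have "s powr (p / 2) + p / 2 * s powr (p / 2 - 1) * ((norm (z + w))\<^sup>2 - s) \<le> ((norm (z + w))\<^sup>2) powr (p / 2)"
    using assms \<open>s > 0\<close> by (intro powr_ge_tangent) auto
  moreover have "s powr (p / 2 - 1) = norm z powr (p - 2)"
    unfolding norm_powr_eq[of z "p - 2"] s_def by (simp add: diff_divide_distrib)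
  moreover have "(norm (z + w))\<^sup>2 - s = 2 * inner z w + (norm w)\<^sup>2"
    by (simp add: norm_plus_sq s_def)
  ultimately have "norm z powr p + p / 2 * norm z powr (p - 2) * (2 * inner z w + (norm w)\<^sup>2)
      \<le> norm (z + w) powr p"
    unfolding norm_powr_eq[of "z + w" p] norm_powr_eq[of z p] s_def by simp
  then show ?thesis unfolding bregman_def by (simp add: field_simps)
qed

lemma bregman_zero [simp]: "bregman p z 0 = 0"
  by (simp add: bregman_def)

lemma mixed_power_nonneg [simp]: "0 \<le> mixed_power p a b"
  by (simp add: mixed_power_def)

lemma abs_inner_powr_le:
  "\<bar>norm z powr (p - 2) * inner z w\<bar> \<le> norm z powr (p - 1) * norm w"
proof (cases "z = 0")
  case False
  have "\<bar>norm z powr (p - 2) * inner z w\<bar> \<le> norm z powr (p - 2) * (norm z * norm w)"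
    by (simp add: abs_mult mult_left_mono Cauchy_Schwarz_ineq2)
  also have "\<dots> = norm z powr (p - 2 + 1) * norm w"
    unfolding powr_add using False by simp
  finally show ?thesis by simp
qed simp

text \<open>If \<open>w\<close> is at least as long as \<open>z\<close>, every term is at most a
  multiple of \<open>norm w powr p\<close>, which is comparable to \<open>mixed_power\<close>. If
  \<open>w\<close> is shorter, \<open>bregman_le_sq\<close> applies and \<open>norm z\<close> is
  comparable to \<open>norm z + norm w\<close>.\<close>

lemma bregman_le:
  fixes z w :: "'a::real_inner"
  assumes p: "1 < p" "p \<le> 2"
  shows "bregman p z w \<le> (2 powr p + p) * 2 powr (2 - p) * mixed_power p (norm z) (norm w)"
proof -
  define a b where "a = norm z" and "b = norm w"
  have ab: "0 \<le> a" "0 \<le> b" by (auto simp: a_def b_def)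
  consider "w = 0" | "0 < b" "a \<le> b" | "b < a" using ab by (force simp: b_def)
  then show ?thesis
  proof cases
    case 2
    have "norm (z + w) \<le> 2 * b"
      using norm_triangle_ineq[of z w] 2 by (simp add: a_def b_def)
    then have sum_le: "norm (z + w) powr p \<le> (2 * b) powr p"
      using p by (intro powr_mono2) auto
    have "\<bar>norm z powr (p - 2) * inner z w\<bar> \<le> b powr (p - 1) * b"
    proof (rule order_trans[OF abs_inner_powr_le])
      show "norm z powr (p - 1) * norm w \<le> b powr (p - 1) * b"
        unfolding a_def[symmetric] b_def[symmetric] using 2 p ab by (intro mult_right_mono powr_mono2) auto
    qed
    moreover have "b powr (p - 1) * b = b powr p" using 2 by (simp add: powr_diff)
    ultimately have "- (norm z powr (p - 2) * inner z w) \<le> b powr p" by linarith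
    then have "p * - (norm z powr (p - 2) * inner z w) \<le> p * b powr p"
      using p by (intro mult_left_mono) auto
    moreover have "norm z powr p \<ge> 0" by simp
    ultimately have "bregman p z w \<le> (2 * b) powr p + p * b powr p"
      using sum_le unfolding bregman_def mult.assoc by linarith
    also have "\<dots> = (2 powr p + p) * 2 powr (2 - p) * ((2 * b) powr (p - 2) * b\<^sup>2)"
    proof -
      have 1: "(2 * b) powr (p - 2) * b\<^sup>2 = 2 powr (p - 2) * b powr p"
        using 2 powr_mult_sq[of b p] by (simp add: powr_mult)
      have 3: "2 powr (2 - p) * 2 powr (p - 2) = (1::real)" by (simp flip: powr_add)
      have 4: "2 powr (2 - p) * ((2 * b) powr (p - 2) * b\<^sup>2) = b powr p"
        unfolding 1 by (simp add: 3 flip: mult.assoc)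
      have "(2 * b) powr p = 2 powr p * b powr p" using 2 by (simp add: powr_mult)
      then show ?thesis unfolding mult.assoc 4 by (simp add: distrib_right)
    qed
    also have "\<dots> \<le> (2 powr p + p) * 2 powr (2 - p) * mixed_power p a b"
      unfolding mixed_power_def using 2 p ab
      by (intro mult_left_mono mult_right_mono powr_mono2') auto
    finally show ?thesis by (simp add: a_def b_def)
  next
    case 3
    then have "a > 0" using ab by simp
    then have "z \<noteq> 0" by (auto simp: a_def)
    have "bregman p z w \<le> p / 2 * (a powr (p - 2) * b\<^sup>2)"
      using bregman_le_sq[of p z w] p \<open>z \<noteq> 0\<close> by (simp add: a_def b_def)
    also have "a powr (p - 2) = 2 powr (2 - p) * (2 * a) powr (p - 2)"
      using \<open>a > 0\<close> by (simp add: powr_mult powr_diff)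
    also have "p / 2 * (2 powr (2 - p) * (2 * a) powr (p - 2) * b\<^sup>2) \<le> p / 2 * (2 powr (2 - p) * (a + b) powr (p - 2) * b\<^sup>2)"
      using 3 p ab \<open>a > 0\<close> by (intro mult_left_mono mult_right_mono powr_mono2') auto
    also have "\<dots> = p / 2 * (2 powr (2 - p) * mixed_power p a b)"
      by (simp add: mixed_power_def)
    also have "\<dots> \<le> (2 powr p + p) * (2 powr (2 - p) * mixed_power p a b)"
      using p by (intro mult_right_mono) (auto intro: add_increasing)
    finally show ?thesis by (simp add: a_def b_def mult.assoc)
  qed (simp add: mixed_power_def)
qed

text \<open>In \<open>bregman_ge\<close> a main term \<open>7 powr p * (b / 8) powr p\<close> has to
  beat error terms with the factors 1 and \<open>8 * p\<close>; this bound leaves one copy of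
  \<open>(b / 8) powr p\<close> over.\<close>

lemma seven_powr_ge:
  fixes p :: real
  assumes "2 \<le> p"
  shows "2 + 8 * p \<le> 7 powr p"
proof -
  have "1 \<le> ln (7::real)"
    using exp_le by (subst ln_ge_iff) auto
  then have "1 + (p - 2) \<le> 1 + (p - 2) * ln 7"
    using mult_left_mono[of 1 "ln 7" "p - 2"] assms by simp
  also have "\<dots> \<le> exp ((p - 2) * ln 7)" by (rule exp_ge_add_one_self)
  also have "\<dots> = 7 powr (p - 2)" by (simp add: powr_def)
  also have "\<dots> = 7 powr p / 49" by (simp add: powr_diff powr_numeral)
  finally show ?thesis using assms by simp
qed

text \<open>If \<open>norm w\<close> is at least 8 times \<open>norm z\<close>, the term
  \<open>norm (z + w) powr p\<close> dominates the others. Otherwise \<open>bregman_ge_sq\<close>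
  applies. The base 16 serves both cases: it is 2 times 8, from \<open>a + b \<le> 2 * b\<close> and
  the scale \<open>b / 8\<close>, and it exceeds 9, from \<open>a + b \<le> 9 * a\<close>.\<close>

lemma bregman_ge:
  fixes z w :: "'a::real_inner"
  assumes p: "2 \<le> p"
  shows "16 powr (- p) * mixed_power p (norm z) (norm w) \<le> bregman p z w"
proof -
  define a b where "a = norm z" and "b = norm w"
  have ab: "0 \<le> a" "0 \<le> b" by (auto simp: a_def b_def)
  consider "w = 0" | "0 < b" "8 * a \<le> b" | "0 < b" "b < 8 * a" using ab by (force simp: b_def)
  then show ?thesis
  proof cases
    case 2
    have "7 / 8 * b \<le> norm (z + w)"
      using norm_triangle_ineq2[of w "-z"] 2 by (simp add: a_def b_def add.commute)
    then have 1: "(7 / 8 * b) powr p \<le> norm (z + w) powr p"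
      using p 2 by (intro powr_mono2) auto
    have 3: "norm z powr p \<le> (b / 8) powr p"
      using p 2 by (intro powr_mono2) (auto simp: a_def)
    have "\<bar>norm z powr (p - 2) * inner z w\<bar> \<le> (b / 8) powr (p - 1) * b"
    proof (rule order_trans[OF abs_inner_powr_le])
      show "norm z powr (p - 1) * norm w \<le> (b / 8) powr (p - 1) * b"
        unfolding a_def[symmetric] b_def[symmetric] using 2 p ab by (intro mult_right_mono powr_mono2) auto
    qed
    also have "\<dots> = 8 * (b / 8) powr p"
      using 2 by (simp add: powr_diff powr_divide field_simps)
    finally have "norm z powr (p - 2) * inner z w \<le> 8 * (b / 8) powr p" by linarith
    then have "p * (norm z powr (p - 2) * inner z w) \<le> p * (8 * (b / 8) powr p)"
      using p by (intro mult_left_mono) auto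
    then have R: "(7 / 8 * b) powr p - (b / 8) powr p - p * (8 * (b / 8) powr p) \<le> bregman p z w"
      using 1 3 unfolding bregman_def by (simp add: mult.assoc)
    have "(7 / 8 * b) powr p = 7 powr p * (b / 8) powr p"
      using 2 by (simp add: powr_mult powr_divide)
    moreover have "(2 + 8 * p) * (b / 8) powr p \<le> 7 powr p * (b / 8) powr p"
      using seven_powr_ge[OF p] by (intro mult_right_mono) auto
    ultimately have "(b / 8) powr p \<le> bregman p z w"
      using R by (simp add: algebra_simps)
    moreover have "16 powr (- p) * mixed_power p a b \<le> (b / 8) powr p"
    proof -
      have "mixed_power p a b \<le> (2 * b) powr (p - 2) * b\<^sup>2"
        unfolding mixed_power_def using 2 p ab by (intro mult_right_mono powr_mono2) auto
      also have "\<dots> = 2 powr (p - 2) * b powr p"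
        using 2 powr_mult_sq[of b p] by (simp add: powr_mult)
      also have "\<dots> \<le> 2 powr p * b powr p"
        by (intro mult_right_mono powr_mono) auto
      finally have "16 powr (- p) * mixed_power p a b \<le> 16 powr (- p) * (2 powr p * b powr p)"
        by (intro mult_left_mono) auto
      also have "\<dots> = (b / 8) powr p"
      proof -
        have "(16::real) powr p = 2 powr p * 8 powr p" by (simp flip: powr_mult)
        then show ?thesis using 2 by (simp add: powr_minus powr_divide field_simps)
      qed
      finally show ?thesis .
    qed
    ultimately show ?thesis by (simp add: a_def b_def)
  next
    case 3
    then have "a > 0" using ab by simp
    then have "z \<noteq> 0" by (auto simp: a_def)
    have "mixed_power p a b \<le> (9 * a) powr (p - 2) * b\<^sup>2"
      unfolding mixed_power_def using 3 p ab by (intro mult_right_mono powr_mono2) auto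
    also have "\<dots> = 9 powr (p - 2) * (a powr (p - 2) * b\<^sup>2)"
      using 3 \<open>a > 0\<close> by (simp add: powr_mult)
    finally have "16 powr (- p) * mixed_power p a b \<le> 16 powr (- p) * (9 powr (p - 2) * (a powr (p - 2) * b\<^sup>2))"
      by (intro mult_left_mono) auto
    also have "\<dots> \<le> 16 powr (- p) * (16 powr p * (a powr (p - 2) * b\<^sup>2))"
    proof -
      have "9 powr (p - 2) \<le> (16::real) powr (p - 2)" using p by (intro powr_mono2) auto
      also have "\<dots> \<le> 16 powr p" by (intro powr_mono) auto
      finally show ?thesis by (intro mult_left_mono mult_right_mono) auto
    qed
    also have "\<dots> = 1 * (a powr (p - 2) * b\<^sup>2)"
      by (simp add: powr_minus)
    also have "\<dots> \<le> p / 2 * (a powr (p - 2) * b\<^sup>2)"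
      using p by (intro mult_right_mono) auto
    also have "\<dots> \<le> bregman p z w"
      using bregman_ge_sq[OF p \<open>z \<noteq> 0\<close>, of w] by (simp add: a_def b_def mult.assoc)
    finally show ?thesis by (simp add: a_def b_def)
  qed (simp add: mixed_power_def)
qed

section \<open>Majorization\<close>

text \<open>A mixture of the hinge functions \<open>b \<mapsto> (b - a)\<^sup>+\<close>: the positive part is implicit, since
  \<^const>\<open>ennreal\<close> maps negative numbers to \<open>0\<close>.\<close>

definition hinge_mean :: "real \<Rightarrow> real \<Rightarrow> real \<Rightarrow> ennreal" where
  "hinge_mean p A b = (\<integral>\<^sup>+ a\<in>{0<..}. ennreal (b - a) * ennreal (max A a powr (p - 2)) \<partial>lborel)"

text \<open>It suffices to integrate over \<open>[b / 2, 3 * b / 4]\<close>: there the hinge is at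
  least \<open>b / 4\<close>, the weight is at least a multiple of
  \<open>(A + b) powr (p - 2)\<close>, and the length is \<open>b / 4\<close>.\<close>

lemma mixed_power_le_hinge_mean:
  assumes "0 \<le> A" "0 \<le> b"
  shows "ennreal (mixed_power p A b) \<le> ennreal (16 * (1 + 3 powr (p - 2))) * hinge_mean p A b"
proof (cases "b = 0")
  case False
  then have b: "b > 0" using assms by simp
  \<comment> \<open>The normalization covers both signs of \<open>p - 2\<close>: on the chosen
    interval \<open>(A + b) / 3 \<le> max A a \<le> A + b\<close>, and dividing by
    \<open>1 + 3 powr (p - 2)\<close> costs at least as much as dividing by 1 or by
    \<open>3 powr (p - 2)\<close>.\<close>
  define w where "w = 1 / (1 + 3 powr (p - 2)) * (A + b) powr (p - 2)"
  have w: "w \<le> max A a powr (p - 2)" if a: "b / 2 \<le> a" "a \<le> 3 * b / 4" for a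
  proof (cases "2 \<le> p")
    case True
    have "w \<le> 1 / 3 powr (p - 2) * (A + b) powr (p - 2)"
      unfolding w_def by (intro mult_right_mono divide_left_mono mult_pos_pos add_pos_pos) auto
    also have "\<dots> = ((A + b) / 3) powr (p - 2)"
      using assms b by (simp add: powr_divide)
    also have "\<dots> \<le> max A a powr (p - 2)"
      using a assms b True by (intro powr_mono2) auto
    finally show ?thesis .
  next
    case False
    have "w \<le> 1 * (A + b) powr (p - 2)"
      unfolding w_def by (intro mult_right_mono) (auto simp: field_simps add_pos_nonneg)
    also have "1 * (A + b) powr (p - 2) \<le> max A a powr (p - 2)"
      using a assms b False by (simp only: mult_1, intro powr_mono2') auto
    finally show ?thesis .
  qed
  have "ennreal (b / 4 * w) * ennreal (b / 4) = (\<integral>\<^sup>+ a. ennreal (b / 4 * w) * indicator {b / 2..3 * b / 4} a \<partial>lborel)"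
    using b by (subst nn_integral_cmult_indicator) auto
  also have "\<dots> \<le> hinge_mean p A b"
    unfolding hinge_mean_def
  proof (intro nn_integral_mono)
    fix a
    show "ennreal (b / 4 * w) * indicator {b / 2..3 * b / 4} a
        \<le> ennreal (b - a) * ennreal (max A a powr (p - 2)) * indicator {0<..} a"
    proof (cases "a \<in> {b / 2..3 * b / 4}")
      case True
      then have "b / 4 * w \<le> (b - a) * max A a powr (p - 2)"
        using w[of a] b by (intro mult_mono) (auto simp: w_def add_nonneg_nonneg)
      then show ?thesis
        using True b by (auto simp: ennreal_mult'[symmetric] intro!: ennreal_leI)
    qed auto
  qed
  finally have le: "ennreal (b / 4 * w) * ennreal (b / 4) \<le> hinge_mean p A b" .
  have eq: "mixed_power p A b = 16 * (1 + 3 powr (p - 2)) * (b / 4 * w * (b / 4))"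
  proof -
    define K where "K = 1 + 3 powr (p - 2)"
    have "K > 0" by (auto simp: K_def intro: add_pos_nonneg)
    then show ?thesis
      unfolding mixed_power_def w_def K_def[symmetric] by (simp add: field_simps power2_eq_square)
  qed
  have "ennreal (mixed_power p A b) = ennreal (16 * (1 + 3 powr (p - 2))) * (ennreal (b / 4 * w) * ennreal (b / 4))"
  proof -
    have *: "ennreal (k * (u * v)) = ennreal k * (ennreal u * ennreal v)" if "0 \<le> k" "0 \<le> u" "0 \<le> v" for k u v
      using that by (simp add: ennreal_mult)
    have "0 \<le> b / 4 * w" using b by (simp add: w_def add_nonneg_nonneg)
    then show ?thesis
      unfolding eq using b by (intro *) auto
  qed
  then show ?thesis
    using le by (simp add: mult_left_mono)
qed (simp add: mixed_power_def)

lemma nn_integral_powr_Ioo: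
  assumes "- 1 < r" "0 \<le> b"
  shows "(\<integral>\<^sup>+ a\<in>{0<..<b}. ennreal (a powr r) \<partial>lborel) = ennreal (b powr (r + 1) / (r + 1))"
proof -
  have "(\<integral>\<^sup>+ a. ennreal (a powr r) * indicator {0..b} a \<partial>lborel) = ennreal (b powr (r + 1) / (r + 1))"
    using has_integral_powr_from_0[OF assms] by (intro nn_integral_has_integral_lebesgue') auto
  moreover have "(\<integral>\<^sup>+ a\<in>{0<..<b}. ennreal (a powr r) \<partial>lborel) = (\<integral>\<^sup>+ a. ennreal (a powr r) * indicator {0..b} a \<partial>lborel)"
  proof (intro nn_integral_cong_AE)
    have "AE a in lborel. a \<noteq> 0 \<and> a \<noteq> b"
      by (intro AE_conjI AE_lborel_singleton)
    then show "AE a in lborel. ennreal (a powr r) * indicator {0<..<b} a = ennreal (a powr r) * indicator {0..b} a"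
      by eventually_elim (auto simp: indicator_def)
  qed
  ultimately show ?thesis by simp
qed

text \<open>The hinge is at most \<open>b\<close> on \<open>(0, b)\<close> and 0 beyond. If
  \<open>2 \<le> p\<close> or \<open>b \<le> A\<close>, the weight is bounded there by a multiple of
  \<open>(A + b) powr (p - 2)\<close>. In the remaining case it is at most
  \<open>a powr (p - 2)\<close>, which is integrable at 0 because \<open>1 < p\<close>.\<close>

lemma hinge_mean_le_mixed_power:
  assumes p: "1 < p" and "0 \<le> A" "0 \<le> b"
  shows "hinge_mean p A b \<le> ennreal (1 + 2 powr (2 - p) + 2 powr (2 - p) / (p - 1)) * ennreal (mixed_power p A b)"
    (is "_ \<le> ennreal ?K * _")
proof (cases "b = 0")
  case True
  then have "hinge_mean p A b = 0"
    unfolding hinge_mean_def by (auto simp: nn_integral_0_iff_AE indicator_def ennreal_neg)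
  then show ?thesis by simp
next
  case False
  then have b: "b > 0" using assms by simp
  have bound: "hinge_mean p A b \<le> ennreal (w * b * b)"
    if w: "0 \<le> w" "\<And>a. 0 < a \<Longrightarrow> a < b \<Longrightarrow> max A a powr (p - 2) \<le> w" for w
  proof -
    have "hinge_mean p A b \<le> (\<integral>\<^sup>+ a. ennreal (w * b) * indicator {0..b} a \<partial>lborel)"
      unfolding hinge_mean_def
    proof (intro nn_integral_mono)
      fix a
      show "ennreal (b - a) * ennreal (max A a powr (p - 2)) * indicator {0<..} a \<le> ennreal (w * b) * indicator {0..b} a"
      proof (cases "a \<in> {0<..<b}")
        case True
        then have "(b - a) * max A a powr (p - 2) \<le> b * w"
          using w b by (intro mult_mono) auto
        then show ?thesis
          using True by (auto simp: ennreal_mult'[symmetric] mult.commute intro!: ennreal_leI)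
      qed (auto simp: indicator_def ennreal_neg)
    qed
    also have "\<dots> = ennreal (w * b) * ennreal b"
      using b by (subst nn_integral_cmult_indicator) auto
    also have "\<dots> = ennreal (w * b * b)" using b w by (simp add: ennreal_mult'')
    finally show ?thesis .
  qed
  have m0: "0 \<le> mixed_power p A b" by simp
  have "hinge_mean p A b \<le> ennreal (?K * mixed_power p A b)"
  proof -
    consider "2 \<le> p" | "p < 2" "b \<le> A" | "p < 2" "A < b" by linarith
    then show ?thesis
    proof cases
      case 1
      have "hinge_mean p A b \<le> ennreal ((A + b) powr (p - 2) * b * b)"
        using assms 1 by (intro bound powr_mono2) auto
      also have "(A + b) powr (p - 2) * b * b = 1 * mixed_power p A b"
        by (simp add: mixed_power_def power2_eq_square)
      also have "ennreal (1 * mixed_power p A b) \<le> ennreal (?K * mixed_power p A b)"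
        using p by (intro ennreal_leI mult_right_mono) auto
      finally show ?thesis .
    next
      case 2
      have "hinge_mean p A b \<le> ennreal (A powr (p - 2) * b * b)"
        using assms 2 b by (intro bound powr_mono2') auto
      also have "A powr (p - 2) = 2 powr (2 - p) * (2 * A) powr (p - 2)"
      proof -
        have "2 powr (2 - p) * 2 powr (p - 2) = (1::real)" by (simp flip: powr_add)
        then show ?thesis using 2 b by (simp add: powr_mult flip: mult.assoc)
      qed
      also have "ennreal (2 powr (2 - p) * (2 * A) powr (p - 2) * b * b)
          \<le> ennreal (2 powr (2 - p) * (A + b) powr (p - 2) * b * b)"
        using 2 b p by (intro ennreal_leI mult_right_mono mult_left_mono powr_mono2') auto
      also have "2 powr (2 - p) * (A + b) powr (p - 2) * b * b = 2 powr (2 - p) * mixed_power p A b"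
        by (simp add: mixed_power_def power2_eq_square)
      also have "ennreal (2 powr (2 - p) * mixed_power p A b) \<le> ennreal (?K * mixed_power p A b)"
        using p by (intro ennreal_leI mult_right_mono) auto
      finally show ?thesis .
    next
      case 3
      have "hinge_mean p A b \<le> (\<integral>\<^sup>+ a. ennreal b * (ennreal (a powr (p - 2)) * indicator {0<..<b} a) \<partial>lborel)"
        unfolding hinge_mean_def
      proof (intro nn_integral_mono)
        fix a
        show "ennreal (b - a) * ennreal (max A a powr (p - 2)) * indicator {0<..} a
            \<le> ennreal b * (ennreal (a powr (p - 2)) * indicator {0<..<b} a)"
        proof (cases "a \<in> {0<..<b}")
          case True
          then have "(b - a) * max A a powr (p - 2) \<le> b * a powr (p - 2)"
            using 3 b by (intro mult_mono powr_mono2') auto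
          then show ?thesis
            using True b by (auto simp: ennreal_mult'[symmetric] intro!: ennreal_leI)
        qed (auto simp: indicator_def ennreal_neg)
      qed
      also have "\<dots> = ennreal b * ennreal (b powr (p - 1) / (p - 1))"
        using nn_integral_powr_Ioo[of "p - 2" b] p b by (subst nn_integral_cmult) auto
      also have "\<dots> = ennreal (b * (b powr (p - 1) / (p - 1)))"
        using b p by (intro ennreal_mult[symmetric]) auto
      also have "b * (b powr (p - 1) / (p - 1)) = 2 powr (2 - p) / (p - 1) * ((2 * b) powr (p - 2) * b\<^sup>2)"
      proof -
        have "2 powr (2 - p) * 2 powr (p - 2) = (1::real)" by (simp flip: powr_add)
        moreover have "b * b powr (p - 1) = b powr p" using b by (simp add: powr_diff)
        moreover have "(2 * b) powr (p - 2) * b\<^sup>2 = 2 powr (p - 2) * b powr p"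
          using b powr_mult_sq[of b p] by (simp add: powr_mult)
        ultimately show ?thesis by (simp flip: mult.assoc)
      qed
      also have "ennreal \<dots> \<le> ennreal (2 powr (2 - p) / (p - 1) * mixed_power p A b)"
        unfolding mixed_power_def using 3 b p assms
        by (intro ennreal_leI mult_right_mono mult_left_mono powr_mono2') auto
      also have "\<dots> \<le> ennreal (?K * mixed_power p A b)"
        using p by (intro ennreal_leI mult_right_mono) auto
      finally show ?thesis .
    qed
  qed
  also have "\<dots> = ennreal ?K * ennreal (mixed_power p A b)"
    using p by (intro ennreal_mult) auto
  finally show ?thesis .
qed

section \<open>The decreasing rearrangement\<close>

context prob_space
begin

text \<open>The tail probability is right-continuous in \<open>s\<close>, so the infimum is
  attained. It tends to 0, so for \<open>0 < t\<close> the set is nonempty. The rearrangement is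
  thus a generalized inverse of the tail.\<close>

lemma decr_rearrangement_le_iff:
  assumes [measurable]: "f \<in> borel_measurable M" and t: "0 < t" and s: "0 \<le> s"
  shows "decr_rearrangement M f t \<le> s \<longleftrightarrow> prob {x \<in> space M. \<bar>f x\<bar> > s} \<le> t"
proof -
  let ?\<mu> = "\<lambda>s. prob {x \<in> space M. \<bar>f x\<bar> > s}"
  define S where "S = {s. 0 \<le> s \<and> ?\<mu> s \<le> t}"
  have decr: "decr_rearrangement M f t = Inf S"
    by (simp add: decr_rearrangement_def S_def)
  have bdd: "bdd_below S" by (rule bdd_belowI[of _ 0]) (simp add: S_def)
  have lim: "(\<lambda>n. ?\<mu> (real n)) \<longlonglongrightarrow> 0"
  proof -
    have "(\<lambda>n. ?\<mu> (real n)) \<longlonglongrightarrow> prob (\<Inter>n. {x \<in> space M. \<bar>f x\<bar> > real n})"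
      by (intro finite_Lim_measure_decseq) (auto simp: decseq_def)
    moreover have "(\<Inter>n. {x \<in> space M. \<bar>f x\<bar> > real n}) = {}"
    proof -
      have "\<exists>n. \<not> real n < \<bar>f x\<bar>" for x
        using reals_Archimedean2[of "\<bar>f x\<bar>"] by (auto intro: less_imp_le simp: not_less)
      then show ?thesis by blast
    qed
    ultimately show ?thesis by simp
  qed
  obtain n where "?\<mu> (real n) < t"
    using order_tendstoD(2)[OF lim t] by (auto simp: eventually_sequentially)
  then have nonempty: "S \<noteq> {}"
    by (auto simp: S_def intro!: exI[of _ "real n"])
  show ?thesis
  proof
    assume "?\<mu> s \<le> t"
    then show "decr_rearrangement M f t \<le> s"
      unfolding decr using s by (intro cInf_lower bdd) (simp add: S_def)
  next
    assume le: "decr_rearrangement M f t \<le> s"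
    \<comment> \<open>The infimum only controls levels above \<open>s\<close>; continuity of the
      measure from below then brings the bound down to \<open>s\<close> itself.\<close>
    have "?\<mu> (s + 1 / Suc n) \<le> t" for n
    proof -
      have "Inf S < s + 1 / Suc n" using le decr by (auto intro: le_less_trans)
      then obtain r where r: "r \<in> S" "r < s + 1 / Suc n"
        using cInf_less_iff[OF nonempty bdd] by blast
      then have "?\<mu> (s + 1 / Suc n) \<le> ?\<mu> r" by (intro finite_measure_mono) auto
      then show ?thesis using r by (simp add: S_def)
    qed
    moreover have "(\<lambda>n. ?\<mu> (s + 1 / Suc n)) \<longlonglongrightarrow> ?\<mu> s"
    proof -
      have "(\<lambda>n. ?\<mu> (s + 1 / Suc n)) \<longlonglongrightarrow> prob (\<Union>n. {x \<in> space M. \<bar>f x\<bar> > s + 1 / Suc n})"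
      proof (intro finite_Lim_measure_incseq)
        show "incseq (\<lambda>n. {x \<in> space M. \<bar>f x\<bar> > s + 1 / Suc n})"
        proof (intro incseq_SucI subsetI)
          fix n x assume "x \<in> {x \<in> space M. \<bar>f x\<bar> > s + 1 / Suc n}"
          moreover have "1 / real (Suc (Suc n)) \<le> 1 / Suc n" by (intro divide_left_mono) auto
          ultimately show "x \<in> {x \<in> space M. \<bar>f x\<bar> > s + 1 / Suc (Suc n)}" by auto
        qed
      qed auto
      moreover have "(\<Union>n. {x \<in> space M. \<bar>f x\<bar> > s + 1 / Suc n}) = {x \<in> space M. \<bar>f x\<bar> > s}"
      proof (intro equalityI subsetI)
        fix x assume "x \<in> {x \<in> space M. \<bar>f x\<bar> > s}"
        moreover from this obtain n where "inverse (real (Suc n)) < \<bar>f x\<bar> - s"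
          using reals_Archimedean[of "\<bar>f x\<bar> - s"] by auto
        ultimately show "x \<in> (\<Union>n. {x \<in> space M. \<bar>f x\<bar> > s + 1 / Suc n})"
          by (auto simp: inverse_eq_divide intro!: exI[of _ n])
      next
        fix x assume "x \<in> (\<Union>n. {x \<in> space M. \<bar>f x\<bar> > s + 1 / Suc n})"
        then obtain n where n: "x \<in> space M" "\<bar>f x\<bar> > s + 1 / Suc n" by auto
        have "s + 0 < s + 1 / Suc n" by (intro add_strict_left_mono) simp
        then have "s < \<bar>f x\<bar>" using n(2) by linarith
        then show "x \<in> {x \<in> space M. \<bar>f x\<bar> > s}" using n by simp
      qed
      ultimately show ?thesis by simp
    qed
    ultimately show "?\<mu> s \<le> t"
      by (intro LIMSEQ_le_const2) auto
  qed
qed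

lemma decr_rearrangement_nonneg:
  assumes "f \<in> borel_measurable M" "0 < t"
  shows "0 \<le> decr_rearrangement M f t"
proof (rule ccontr)
  assume "\<not> ?thesis"
  then have neg: "Inf {s. 0 \<le> s \<and> prob {x \<in> space M. \<bar>f x\<bar> > s} \<le> t} < 0"
    by (simp add: decr_rearrangement_def)
  have "decr_rearrangement M f t \<le> \<bar>decr_rearrangement M f t\<bar>" by simp
  then have "\<bar>decr_rearrangement M f t\<bar> \<in> {s. 0 \<le> s \<and> prob {x \<in> space M. \<bar>f x\<bar> > s} \<le> t}"
    using decr_rearrangement_le_iff[OF assms] by simp
  then have "0 \<le> Inf {s. 0 \<le> s \<and> prob {x \<in> space M. \<bar>f x\<bar> > s} \<le> t}"
    by (intro cInf_greatest) blast+
  with neg show False by simp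
qed

abbreviation (input) "unit_Ioo \<equiv> restrict_space lborel {0<..<1::real}"

text \<open>By \<open>decr_rearrangement_le_iff\<close> the sublevel sets within the open unit
  interval are intervals.\<close>

lemma measurable_decr_rearrangement:
  assumes "f \<in> borel_measurable M"
  shows "decr_rearrangement M f \<in> borel_measurable (restrict_space lborel {0<..<1})"
proof (rule borel_measurableI_le)
  fix r :: real
  have "{x \<in> space unit_Ioo. decr_rearrangement M f x \<le> r}
      = (if r < 0 then {} else {prob {x \<in> space M. \<bar>f x\<bar> > r}..} \<inter> {0<..<1})"
    using decr_rearrangement_le_iff[OF assms] decr_rearrangement_nonneg[OF assms]
    by (force simp: space_restrict_space)
  then show "{x \<in> space unit_Ioo. decr_rearrangement M f x \<le> r} \<in> sets unit_Ioo"
    by (auto simp: sets_restrict_space)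
qed

text \<open>Equimeasurability, by comparing distribution functions: for \<open>0 \<le> r\<close> the
  sublevel set of the rearrangement runs from \<open>m = prob {|f| > r}\<close> to 1 and has length
  \<open>1 - m\<close>.\<close>

lemma distr_decr_rearrangement:
  assumes f[measurable]: "f \<in> borel_measurable M"
  shows "distr (restrict_space lborel {0<..<1}) borel (decr_rearrangement M f) = distr M borel (\<lambda>x. \<bar>f x\<bar>)"
proof (rule cdf_unique)
  have u: "prob_space unit_Ioo"
    by (rule prob_spaceI) (simp add: emeasure_restrict_space space_restrict_space)
  note [measurable] = measurable_decr_rearrangement[OF f]
  show "real_distribution (distr unit_Ioo borel (decr_rearrangement M f))"
    using prob_space.real_distribution_distr[OF u] by simp
  show "real_distribution (distr M borel (\<lambda>x. \<bar>f x\<bar>))"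
    by (rule real_distribution_distr) simp
  show "cdf (distr unit_Ioo borel (decr_rearrangement M f)) = cdf (distr M borel (\<lambda>x. \<bar>f x\<bar>))"
  proof
    fix r :: real
    define m where "m = prob {x \<in> space M. \<bar>f x\<bar> > r}"
    have m: "0 \<le> m" "m \<le> 1" by (auto simp: m_def)
    have "cdf (distr unit_Ioo borel (decr_rearrangement M f)) r
        = measure unit_Ioo {t \<in> space unit_Ioo. decr_rearrangement M f t \<le> r}"
      unfolding cdf_def by (subst measure_distr) (auto intro!: arg_cong[where f = "measure unit_Ioo"])
    also have "\<dots> = measure M {x \<in> space M. \<bar>f x\<bar> \<le> r}"
    proof (cases "r < 0")
      case True
      then have "{t \<in> space unit_Ioo. decr_rearrangement M f t \<le> r} = {}" "{x \<in> space M. \<bar>f x\<bar> \<le> r} = {}"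
        using decr_rearrangement_nonneg[OF f] by (force simp: space_restrict_space)+
      then show ?thesis by (simp only: measure_empty)
    next
      case False
      then have "{t \<in> space unit_Ioo. decr_rearrangement M f t \<le> r} = {m..} \<inter> {0<..<1}"
        using decr_rearrangement_le_iff[OF f] by (force simp: space_restrict_space m_def)
      then have "measure unit_Ioo {t \<in> space unit_Ioo. decr_rearrangement M f t \<le> r} = measure lborel ({m..} \<inter> {0<..<1})"
        by (simp add: measure_restrict_space)
      also have "\<dots> = 1 - m"
      proof (cases "m = 0")
        case True
        then have "{m..} \<inter> {0<..<1} = {0<..<1}" by auto
        then show ?thesis using True by simp
      next
        case False
        then have "{m..} \<inter> {0<..<1} = {m..<1}" using m by auto
        then show ?thesis using m by simp
      qed
      also have "\<dots> = prob (space M - {x \<in> space M. \<bar>f x\<bar> > r})"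
        unfolding m_def by (subst prob_compl) auto
      also have "space M - {x \<in> space M. \<bar>f x\<bar> > r} = {x \<in> space M. \<bar>f x\<bar> \<le> r}" by auto
      finally show ?thesis .
    qed
    also have "\<dots> = cdf (distr M borel (\<lambda>x. \<bar>f x\<bar>)) r"
      unfolding cdf_def by (subst measure_distr) (auto intro!: arg_cong[where f = "measure M"])
    finally show "cdf (distr unit_Ioo borel (decr_rearrangement M f)) r = cdf (distr M borel (\<lambda>x. \<bar>f x\<bar>)) r" .
  qed
qed

lemma nn_integral_decr_rearrangement:
  assumes f[measurable]: "f \<in> borel_measurable M" and h[measurable]: "h \<in> borel_measurable borel"
  shows "(\<integral>\<^sup>+ t\<in>{0<..<1}. h (decr_rearrangement M f t) \<partial>lborel) = (\<integral>\<^sup>+ x. h \<bar>f x\<bar> \<partial>M)"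
proof -
  note [measurable] = measurable_decr_rearrangement[OF f]
  have "(\<integral>\<^sup>+ t\<in>{0<..<1}. h (decr_rearrangement M f t) \<partial>lborel)
      = (\<integral>\<^sup>+ t. h (decr_rearrangement M f t) \<partial>unit_Ioo)"
    by (subst nn_integral_restrict_space) auto
  also have "\<dots> = (\<integral>\<^sup>+ y. h y \<partial>distr unit_Ioo borel (decr_rearrangement M f))"
    by (subst nn_integral_distr) auto
  also have "\<dots> = (\<integral>\<^sup>+ x. h \<bar>f x\<bar> \<partial>M)"
    unfolding distr_decr_rearrangement[OF f] by (subst nn_integral_distr) auto
  finally show ?thesis .
qed

lemma measurable_decr_rearrangement_indicator:
  assumes "f \<in> borel_measurable M" "t \<le> 1"
  shows "(\<lambda>s. ennreal (decr_rearrangement M f s) * indicator {0<..<t} s) \<in> borel_measurable lborel"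
proof -
  have "(\<lambda>s. ennreal (decr_rearrangement M f s)) \<in> borel_measurable (restrict_space lborel {0<..<1})"
    using measurable_decr_rearrangement[OF assms(1)] by measurable
  then have "(\<lambda>s. ennreal (decr_rearrangement M f s) * indicator {0<..<1} s) \<in> borel_measurable lborel"
    by (subst (asm) borel_measurable_restrict_space_iff_ennreal) auto
  then have "(\<lambda>s. ennreal (decr_rearrangement M f s) * indicator {0<..<1} s * indicator {0<..<t} s) \<in> borel_measurable lborel"
    by measurable
  also have "(\<lambda>s. ennreal (decr_rearrangement M f s) * indicator {0<..<1} s * indicator {0<..<t} s)
      = (\<lambda>s. ennreal (decr_rearrangement M f s) * indicator {0<..<t} s)"
    using assms(2) by (auto simp: fun_eq_iff indicator_def)
  finally show ?thesis .
qed

text \<open>With \<open>m = prob {|f| > a}\<close>, the rearrangement of \<open>f\<close> exceeds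
  \<open>a\<close> exactly on \<open>(0, m)\<close>, so the hinge integral of \<open>f\<close> is
  the integral of its rearrangement minus \<open>a\<close> over \<open>(0, m)\<close>. For
  \<open>g\<close> the same expression is at most the hinge integral. Adding \<open>a * m\<close> on
  both sides avoids subtraction in \<open>ennreal\<close>; it is finite and cancels at the
  end.\<close>

lemma nn_integral_hinge_mono_rearrangement:
  assumes f[measurable]: "f \<in> borel_measurable M" and g[measurable]: "g \<in> borel_measurable M"
    and le: "\<And>t. t \<in> {0..1} \<Longrightarrow> (\<integral>\<^sup>+ s\<in>{0<..<t}. ennreal (decr_rearrangement M f s) \<partial>lborel)
        \<le> (\<integral>\<^sup>+ s\<in>{0<..<t}. ennreal (decr_rearrangement M g s) \<partial>lborel)"
    and a: "0 \<le> a"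
  shows "(\<integral>\<^sup>+ x. ennreal (\<bar>f x\<bar> - a) \<partial>M) \<le> (\<integral>\<^sup>+ x. ennreal (\<bar>g x\<bar> - a) \<partial>M)"
proof -
  define m where "m = prob {x \<in> space M. \<bar>f x\<bar> > a}"
  have m: "0 \<le> m" "m \<le> 1" by (auto simp: m_def)
  \<comment> \<open>The bound \<open>m\<close> is the one belonging to \<open>f\<close>, also when
    this identity is used for \<open>g\<close>.\<close>
  have hinge: "(\<integral>\<^sup>+ x. ennreal (\<bar>h x\<bar> - a) \<partial>M) + ennreal (a * m)
      = (\<integral>\<^sup>+ t. ennreal (decr_rearrangement M h t - a) * indicator {0<..<1} t
          + ennreal a * indicator {0<..<m} t \<partial>lborel)" if h[measurable]: "h \<in> borel_measurable M" for h
  proof -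
    have "(\<lambda>s. ennreal (decr_rearrangement M h s - a)) \<in> borel_measurable (restrict_space lborel {0<..<1})"
      using measurable_decr_rearrangement[OF h] by measurable
    then have [measurable]: "(\<lambda>s. ennreal (decr_rearrangement M h s - a) * indicator {0<..<1} s) \<in> borel_measurable lborel"
      by (subst (asm) borel_measurable_restrict_space_iff_ennreal) auto
    have "(\<integral>\<^sup>+ t. ennreal (decr_rearrangement M h t - a) * indicator {0<..<1} t
          + ennreal a * indicator {0<..<m} t \<partial>lborel)
        = (\<integral>\<^sup>+ t\<in>{0<..<1}. ennreal (decr_rearrangement M h t - a) \<partial>lborel) + (\<integral>\<^sup>+ t. ennreal a * indicator {0<..<m} t \<partial>lborel)"
      by (subst nn_integral_add) auto
    also have "(\<integral>\<^sup>+ t\<in>{0<..<1}. ennreal (decr_rearrangement M h t - a) \<partial>lborel) = (\<integral>\<^sup>+ x. ennreal (\<bar>h x\<bar> - a) \<partial>M)"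
      by (rule nn_integral_decr_rearrangement[OF h, where h = "\<lambda>y. ennreal (y - a)"]) measurable
    also have "(\<integral>\<^sup>+ t. ennreal a * indicator {0<..<m} t \<partial>lborel) = ennreal (a * m)"
      using m a by (subst nn_integral_cmult_indicator) (auto simp: ennreal_mult')
    finally show ?thesis by simp
  qed
  have "(\<integral>\<^sup>+ x. ennreal (\<bar>f x\<bar> - a) \<partial>M) + ennreal (a * m)
      = (\<integral>\<^sup>+ s\<in>{0<..<m}. ennreal (decr_rearrangement M f s) \<partial>lborel)"
    unfolding hinge[OF f]
  proof (intro nn_integral_cong)
    fix t :: real
    have "decr_rearrangement M f t \<le> a \<longleftrightarrow> m \<le> t" if "0 < t"
      using decr_rearrangement_le_iff[OF f that a] by (simp add: m_def)
    then show "ennreal (decr_rearrangement M f t - a) * indicator {0<..<1} t + ennreal a * indicator {0<..<m} t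
        = ennreal (decr_rearrangement M f t) * indicator {0<..<m} t"
      using m a by (auto simp: indicator_def ennreal_neg not_le simp flip: ennreal_plus)
  qed
  also have "\<dots> \<le> (\<integral>\<^sup>+ s\<in>{0<..<m}. ennreal (decr_rearrangement M g s) \<partial>lborel)"
    using m by (intro le) auto
  also have "\<dots> \<le> (\<integral>\<^sup>+ x. ennreal (\<bar>g x\<bar> - a) \<partial>M) + ennreal (a * m)"
    unfolding hinge[OF g]
  proof (intro nn_integral_mono)
    fix t :: real
    have "ennreal (decr_rearrangement M g t) \<le> ennreal (decr_rearrangement M g t - a) + ennreal a"
    proof (cases "decr_rearrangement M g t \<le> a")
      case True
      then show ?thesis by (simp add: ennreal_neg ennreal_leI)
    next
      case False
      then show ?thesis using a by (simp flip: ennreal_plus)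
    qed
    then show "ennreal (decr_rearrangement M g t) * indicator {0<..<m} t
        \<le> ennreal (decr_rearrangement M g t - a) * indicator {0<..<1} t + ennreal a * indicator {0<..<m} t"
      using m by (auto simp: indicator_def)
  qed
  finally show ?thesis by (simp add: add.commute[of _ "ennreal (a * m)"] ennreal_add_left_cancel_le)
qed

end

section \<open>From hinge functions to \<open>mixed_power\<close>\<close>

lemma measurable_hinge_mean [measurable]: "hinge_mean p A \<in> borel_measurable borel"
  unfolding hinge_mean_def by measurable

text \<open>By Tonelli the integral of a mixture of hinges is the mixture of the hinge integrals,
  with nonnegative weights supported on \<open>a > 0\<close>.\<close>

lemma nn_integral_hinge_mean_mono:
  assumes "sigma_finite_measure M"
    and [measurable]: "f \<in> borel_measurable M" "g \<in> borel_measurable M"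
    and le: "\<And>a. 0 \<le> a \<Longrightarrow> (\<integral>\<^sup>+ x. ennreal (f x - a) \<partial>M) \<le> (\<integral>\<^sup>+ x. ennreal (g x - a) \<partial>M)"
  shows "(\<integral>\<^sup>+ x. hinge_mean p A (f x) \<partial>M) \<le> (\<integral>\<^sup>+ x. hinge_mean p A (g x) \<partial>M)"
proof -
  interpret sigma_finite_measure M by fact
  interpret pair_sigma_finite lborel M by unfold_locales
  have swap: "(\<integral>\<^sup>+ x. hinge_mean p A (h x) \<partial>M)
      = (\<integral>\<^sup>+ a. (\<integral>\<^sup>+ x. ennreal (h x - a) \<partial>M) * (ennreal (max A a powr (p - 2)) * indicator {0<..} a) \<partial>lborel)"
    if [measurable]: "h \<in> borel_measurable M" for h
  proof -
    have "(\<integral>\<^sup>+ x. hinge_mean p A (h x) \<partial>M)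
        = (\<integral>\<^sup>+ a. \<integral>\<^sup>+ x. ennreal (h x - a) * ennreal (max A a powr (p - 2)) * indicator {0<..} a \<partial>M \<partial>lborel)"
      unfolding hinge_mean_def by (rule Fubini') measurable
    also have "\<dots> = (\<integral>\<^sup>+ a. (\<integral>\<^sup>+ x. ennreal (h x - a) \<partial>M) * (ennreal (max A a powr (p - 2)) * indicator {0<..} a) \<partial>lborel)"
      by (intro nn_integral_cong) (simp add: nn_integral_multc mult.assoc)
    finally show ?thesis .
  qed
  show ?thesis
    unfolding swap[OF \<open>f \<in> _\<close>] swap[OF \<open>g \<in> _\<close>]
  proof (intro nn_integral_mono)
    fix a
    show "(\<integral>\<^sup>+ x. ennreal (f x - a) \<partial>M) * (ennreal (max A a powr (p - 2)) * indicator {0<..} a)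
        \<le> (\<integral>\<^sup>+ x. ennreal (g x - a) \<partial>M) * (ennreal (max A a powr (p - 2)) * indicator {0<..} a)"
      by (cases "0 < a") (auto intro!: mult_right_mono le)
  qed
qed

text \<open>The product of the constants in the two comparisons of \<open>mixed_power\<close> with
  \<open>hinge_mean\<close>.\<close>

definition mixed_const :: "real \<Rightarrow> real" where
  "mixed_const p = 16 * (1 + 3 powr (p - 2)) * (1 + 2 powr (2 - p) + 2 powr (2 - p) / (p - 1))"

lemma mixed_const_pos: "1 < p \<Longrightarrow> 0 < mixed_const p"
  unfolding mixed_const_def by (intro mult_pos_pos add_pos_nonneg) auto

lemma nn_integral_mixed_power_mono:
  assumes p: "1 < p" and A: "0 \<le> A" and "sigma_finite_measure M"
    and [measurable]: "f \<in> borel_measurable M" "g \<in> borel_measurable M"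
    and le: "\<And>a. 0 \<le> a \<Longrightarrow> (\<integral>\<^sup>+ x. ennreal (\<bar>f x\<bar> - a) \<partial>M) \<le> (\<integral>\<^sup>+ x. ennreal (\<bar>g x\<bar> - a) \<partial>M)"
  shows "(\<integral>\<^sup>+ x. ennreal (mixed_power p A \<bar>f x\<bar>) \<partial>M)
    \<le> ennreal (mixed_const p) * (\<integral>\<^sup>+ x. ennreal (mixed_power p A \<bar>g x\<bar>) \<partial>M)"
proof -
  let ?K = "16 * (1 + 3 powr (p - 2))" and ?L = "1 + 2 powr (2 - p) + 2 powr (2 - p) / (p - 1)"
  have [measurable]: "mixed_power p A \<in> borel_measurable borel"
    unfolding mixed_power_def by measurable
  have "(\<integral>\<^sup>+ x. ennreal (mixed_power p A \<bar>f x\<bar>) \<partial>M) \<le> (\<integral>\<^sup>+ x. ennreal ?K * hinge_mean p A \<bar>f x\<bar> \<partial>M)"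
    using A by (intro nn_integral_mono mixed_power_le_hinge_mean) auto
  also have "\<dots> = ennreal ?K * (\<integral>\<^sup>+ x. hinge_mean p A \<bar>f x\<bar> \<partial>M)"
    by (rule nn_integral_cmult) measurable
  also have "\<dots> \<le> ennreal ?K * (\<integral>\<^sup>+ x. hinge_mean p A \<bar>g x\<bar> \<partial>M)"
    using le by (intro mult_left_mono nn_integral_hinge_mean_mono \<open>sigma_finite_measure M\<close>) auto
  also have "\<dots> \<le> ennreal ?K * (\<integral>\<^sup>+ x. ennreal ?L * ennreal (mixed_power p A \<bar>g x\<bar>) \<partial>M)"
    using A p by (intro mult_left_mono nn_integral_mono hinge_mean_le_mixed_power) auto
  also have "\<dots> = ennreal ?K * (ennreal ?L * (\<integral>\<^sup>+ x. ennreal (mixed_power p A \<bar>g x\<bar>) \<partial>M))"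
    by (subst nn_integral_cmult) auto
  also have "\<dots> = (ennreal ?K * ennreal ?L) * (\<integral>\<^sup>+ x. ennreal (mixed_power p A \<bar>g x\<bar>) \<partial>M)"
    by (simp only: mult.assoc)
  also have "ennreal ?K * ennreal ?L = ennreal (mixed_const p)"
    unfolding mixed_const_def using p by (intro ennreal_mult[symmetric]) (auto intro!: add_nonneg_nonneg)
  finally show ?thesis .
qed

section \<open>Integration over one coordinate of the cube\<close>

lemma space_cube: "space cube = {1..} \<rightarrow>\<^sub>E {0..1}"
  by (simp add: cube_def space_PiM space_unit_measure)

lemma space_coord_algebra [simp]: "space (coord_algebra k) = space cube"
  using subalgebra_coord_algebra[of k] by (simp add: subalgebra_def)

lemma sets_coord_algebra:
  "sets (coord_algebra k) = sigma_sets (space cube)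
     (\<Union>i\<in>{1..k}. {(\<lambda>x. x i) -` A \<inter> space cube | A. A \<in> sets unit_measure})"
  unfolding coord_algebra_def by (rule sets_measure_of) auto

lemma sets_coord_algebra_mono: "j \<le> k \<Longrightarrow> sets (coord_algebra j) \<subseteq> sets (coord_algebra k)"
  unfolding sets_coord_algebra by (intro sigma_sets_mono' UN_mono) auto

lemma measurable_coord_algebra_mono:
  "f \<in> measurable (coord_algebra j) N \<Longrightarrow> j \<le> k \<Longrightarrow> f \<in> measurable (coord_algebra k) N"
  using measurable_from_subalg[of "coord_algebra k" "coord_algebra j"] sets_coord_algebra_mono[of j k]
  by (simp add: subalgebra_def)

lemma fun_upd_in_space_cube:
  assumes "1 \<le> k" "u \<in> {0..1}" "x \<in> space cube"
  shows "x(k := u) \<in> space cube"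
  using assms by (auto simp: space_cube PiE_iff extensional_def)

text \<open>Every set of the algebra is invariant under changing coordinate \<open>k\<close>: the
  generators do not see it, and complements and unions inherit this. Applied to the level set of
  \<open>f\<close> through \<open>x\<close>, which is measurable because points are closed in a
  \<open>t1_space\<close>, this gives the equality.\<close>

lemma coord_algebra_upd_invariant:
  assumes f: "f \<in> borel_measurable (coord_algebra j)" and "j < k" "1 \<le> k" "u \<in> {0..1}" "x \<in> space cube"
  shows "f (x(k := u)) = (f x :: 'b :: t1_space)"
proof -
  have inv: "x \<in> A \<longleftrightarrow> x(k := u) \<in> A" if "A \<in> sets (coord_algebra j)" for A
    using that unfolding sets_coord_algebra
  proof (induction A rule: sigma_sets.induct)
    case (Basic A)
    then obtain i B where i: "i \<in> {1..j}" and A: "A = (\<lambda>x. x i) -` B \<inter> space cube" by blast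
    from i \<open>j < k\<close> have "(x(k := u)) i = x i" by simp
    then show ?case
      unfolding A using fun_upd_in_space_cube[OF assms(3-5)] assms(5) by (simp only: Int_iff vimage_eq)
  next
    case (Compl A)
    then show ?case using assms(5) fun_upd_in_space_cube[OF assms(3-5)] by blast
  qed auto
  have "f -` {f x} \<inter> space (coord_algebra j) \<in> sets (coord_algebra j)"
    by (rule measurable_sets[OF f]) auto
  from inv[OF this] show ?thesis using assms by simp
qed

lemma measurable_cube_upd:
  assumes "1 \<le> k"
  shows "(\<lambda>(u, x). x(k := u)) \<in> measurable (unit_measure \<Otimes>\<^sub>M cube) cube"
proof -
  have "(\<lambda>w. (snd w)(k := fst w)) \<in> measurable (unit_measure \<Otimes>\<^sub>M cube) cube"
    unfolding cube_def using assms
    by (intro measurable_fun_upd[where J = "{1..}"] measurable_snd measurable_fst) auto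
  then show ?thesis by (simp add: case_prod_beta')
qed

lemma measurable_cube_section:
  assumes "1 \<le> k" "x \<in> space cube" "f \<in> measurable cube N"
  shows "(\<lambda>u. f (x(k := u))) \<in> measurable unit_measure N"
proof -
  have "(\<lambda>u. x(k := u)) \<in> measurable unit_measure cube"
    using measurable_compose[OF measurable_Pair2'[OF assms(2)] measurable_cube_upd[OF assms(1)]] by simp
  then show ?thesis using assms(3) by (rule measurable_compose)
qed

text \<open>Replacing coordinate \<open>k\<close> by an independent uniform variable preserves the
  product measure; the rest is Tonelli.\<close>

lemma nn_integral_cube_section:
  assumes k: "1 \<le> k" and h: "h \<in> borel_measurable cube"
  shows "(\<integral>\<^sup>+ x. h x \<partial>cube) = (\<integral>\<^sup>+ x. \<integral>\<^sup>+ u. h (x(k := u)) \<partial>unit_measure \<partial>cube)"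
proof -
  interpret U: prob_space unit_measure by (rule prob_space_unit_measure)
  interpret Q: prob_space cube by (rule prob_space_cube)
  interpret pair_sigma_finite unit_measure cube by unfold_locales
  note [measurable] = h measurable_cube_upd[OF k]
  \<comment> \<open>The index \<open>k\<close> already belongs to the index set, so the library's
    extension by one coordinate merely overwrites it.\<close>
  have "insert k {1..} = {1..}" using k by auto
  then have "distr (unit_measure \<Otimes>\<^sub>M cube) cube (\<lambda>(u, x). x(k := u)) = cube"
    using distr_pair_PiM_eq_PiM[of "{1..}" "\<lambda>_. unit_measure" k] prob_space_unit_measure
    by (simp add: cube_def)
  then have "(\<integral>\<^sup>+ x. h x \<partial>cube) = (\<integral>\<^sup>+ x. h x \<partial>distr (unit_measure \<Otimes>\<^sub>M cube) cube (\<lambda>(u, x). x(k := u)))"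
    by simp
  also have "\<dots> = (\<integral>\<^sup>+ w. h ((\<lambda>(u, x). x(k := u)) w) \<partial>(unit_measure \<Otimes>\<^sub>M cube))"
    by (subst nn_integral_distr) auto
  also have "\<dots> = (\<integral>\<^sup>+ x. \<integral>\<^sup>+ u. h (x(k := u)) \<partial>unit_measure \<partial>cube)"
    by (subst nn_integral_snd[symmetric]) (auto simp: case_prod_beta')
  finally show ?thesis .
qed

text \<open>The exceptional null set of the majorization may depend on \<open>t\<close>. A common
  one is available for rational \<open>t\<close>, and this lemma recovers the other \<open>t\<close>
  by Fatou's lemma along rationals \<open>q n\<close> below \<open>t\<close>. On the side of
  \<open>G\<close> monotonicity of the integral suffices.\<close>

lemma nn_integral_Ioo_le_rational:
  fixes F G :: "real \<Rightarrow> ennreal"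
  assumes meas: "\<And>t. t \<le> 1 \<Longrightarrow> (\<lambda>s. F s * indicator {0<..<t} s) \<in> borel_measurable lborel"
    and le: "\<And>q. q \<in> \<rat> \<Longrightarrow> q \<in> {0..1} \<Longrightarrow> (\<integral>\<^sup>+ s\<in>{0<..<q}. F s \<partial>lborel) \<le> (\<integral>\<^sup>+ s\<in>{0<..<q}. G s \<partial>lborel)"
    and t: "t \<in> {0..1}"
  shows "(\<integral>\<^sup>+ s\<in>{0<..<t}. F s \<partial>lborel) \<le> (\<integral>\<^sup>+ s\<in>{0<..<t}. G s \<partial>lborel)"
proof (cases "t = 0")
  case False
  then have "t > 0" using t by simp
  have "\<exists>q. q \<in> \<rat> \<and> max 0 (t - 1 / Suc n) < q \<and> q < t" for n :: nat
    using Rats_dense_in_real[of "max 0 (t - 1 / Suc n)" t] \<open>t > 0\<close> by auto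
  then obtain q where q: "\<And>n. q n \<in> \<rat>" "\<And>n. max 0 (t - 1 / Suc n) < q n" "\<And>n. q n < t"
    by metis
  have q01: "q n \<in> {0..1}" for n using q[of n] t by auto
  have lim: "q \<longlonglongrightarrow> t"
  proof (rule tendsto_sandwich)
    show "(\<lambda>n. t - 1 / Suc n) \<longlonglongrightarrow> t"
      using tendsto_diff[OF tendsto_const LIMSEQ_inverse_real_of_nat, of t] by (simp add: inverse_eq_divide)
    show "\<forall>\<^sub>F n in sequentially. t - 1 / Suc n \<le> q n" using q(2) by (auto simp: less_imp_le)
    show "\<forall>\<^sub>F n in sequentially. q n \<le> t" using q(3) by (auto simp: less_imp_le)
  qed auto
  have "(\<integral>\<^sup>+ s\<in>{0<..<t}. F s \<partial>lborel) \<le> (\<integral>\<^sup>+ s. liminf (\<lambda>n. F s * indicator {0<..<q n} s) \<partial>lborel)"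
  proof (intro nn_integral_mono)
    fix s
    show "F s * indicator {0<..<t} s \<le> liminf (\<lambda>n. F s * indicator {0<..<q n} s)"
    proof (cases "s \<in> {0<..<t}")
      case True
      then have "\<forall>\<^sub>F n in sequentially. s < q n" using order_tendstoD(1)[OF lim] by auto
      then have "\<forall>\<^sub>F n in sequentially. F s * indicator {0<..<t} s \<le> F s * indicator {0<..<q n} s"
        by eventually_elim (use True in auto)
      then show ?thesis by (rule Liminf_bounded)
    qed auto
  qed
  also have "\<dots> \<le> liminf (\<lambda>n. \<integral>\<^sup>+ s. F s * indicator {0<..<q n} s \<partial>lborel)"
    using q01 by (intro nn_integral_liminf meas) auto
  also have "\<dots> \<le> liminf (\<lambda>n. \<integral>\<^sup>+ s\<in>{0<..<t}. G s \<partial>lborel)"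
  proof (intro Liminf_mono always_eventually allI)
    fix n
    have "(\<integral>\<^sup>+ s\<in>{0<..<q n}. F s \<partial>lborel) \<le> (\<integral>\<^sup>+ s\<in>{0<..<q n}. G s \<partial>lborel)"
      using q01 q by (intro le) auto
    also have "\<dots> \<le> (\<integral>\<^sup>+ s\<in>{0<..<t}. G s \<partial>lborel)"
      using q(3)[of n] by (intro nn_integral_mono mult_left_mono) (auto simp: indicator_def)
    finally show "(\<integral>\<^sup>+ s\<in>{0<..<q n}. F s \<partial>lborel) \<le> (\<integral>\<^sup>+ s\<in>{0<..<t}. G s \<partial>lborel)" .
  qed
  also have "\<dots> = (\<integral>\<^sup>+ s\<in>{0<..<t}. G s \<partial>lborel)" by (simp add: Liminf_const)
  finally show ?thesis .
qed simp

lemma (in prob_space) nn_integral_mixed_power_mono_rearrangement: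
  assumes "1 < p" "0 \<le> A"
    and f: "f \<in> borel_measurable M" and g: "g \<in> borel_measurable M"
    and le: "\<And>q. q \<in> \<rat> \<Longrightarrow> q \<in> {0..1} \<Longrightarrow>
        (\<integral>\<^sup>+ s\<in>{0<..<q}. ennreal (decr_rearrangement M f s) \<partial>lborel)
        \<le> (\<integral>\<^sup>+ s\<in>{0<..<q}. ennreal (decr_rearrangement M g s) \<partial>lborel)"
  shows "(\<integral>\<^sup>+ x. ennreal (mixed_power p A \<bar>f x\<bar>) \<partial>M)
    \<le> ennreal (mixed_const p) * (\<integral>\<^sup>+ x. ennreal (mixed_power p A \<bar>g x\<bar>) \<partial>M)"
proof (rule nn_integral_mixed_power_mono[OF assms(1,2) sigma_finite_measure_axioms f g])
  fix a :: real assume a: "0 \<le> a"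
  show "(\<integral>\<^sup>+ x. ennreal (\<bar>f x\<bar> - a) \<partial>M) \<le> (\<integral>\<^sup>+ x. ennreal (\<bar>g x\<bar> - a) \<partial>M)"
  proof (rule nn_integral_hinge_mono_rearrangement[OF f g _ a])
    fix t :: real assume t: "t \<in> {0..1}"
    show "(\<integral>\<^sup>+ s\<in>{0<..<t}. ennreal (decr_rearrangement M f s) \<partial>lborel)
        \<le> (\<integral>\<^sup>+ s\<in>{0<..<t}. ennreal (decr_rearrangement M g s) \<partial>lborel)"
      by (rule nn_integral_Ioo_le_rational[OF measurable_decr_rearrangement_indicator[OF f] le t])
  qed
qed

text \<open>\<open>V\<close> does not depend on coordinate \<open>k\<close>, so on each section it
  is a constant and the inequality for one probability space applies. Integrating over the sections
  gives the claim.\<close>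

lemma nn_integral_mixed_power_section_le:
  assumes p: "1 < p" and k: "1 \<le> k"
    and f: "f \<in> borel_measurable cube" and g: "g \<in> borel_measurable cube"
    and V: "V \<in> borel_measurable (coord_algebra (k - 1))" "\<And>x. 0 \<le> V x"
    and le: "\<And>t. t \<in> {0..1} \<Longrightarrow> AE x in cube.
        (\<integral>\<^sup>+ s\<in>{0<..<t}. ennreal (decr_rearrangement unit_measure (coord_section k f x) s) \<partial>lborel)
        \<le> (\<integral>\<^sup>+ s\<in>{0<..<t}. ennreal (decr_rearrangement unit_measure (coord_section k g x) s) \<partial>lborel)"
  shows "(\<integral>\<^sup>+ x. ennreal (mixed_power p (V x) \<bar>f x\<bar>) \<partial>cube)
    \<le> ennreal (mixed_const p) * (\<integral>\<^sup>+ x. ennreal (mixed_power p (V x) \<bar>g x\<bar>) \<partial>cube)"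
proof -
  interpret U: prob_space unit_measure by (rule prob_space_unit_measure)
  note [measurable] = f g
  interpret Q: prob_space cube by (rule prob_space_cube)
  have [measurable]: "V \<in> borel_measurable cube"
    using V(1) subalgebra_coord_algebra by (rule measurable_from_subalg[rotated])
  have mixed: "(\<lambda>x. ennreal (mixed_power p (V x) \<bar>h x\<bar>)) \<in> borel_measurable cube"
    if [measurable]: "h \<in> borel_measurable cube" for h
    unfolding mixed_power_def by measurable
  have unfold: "(\<integral>\<^sup>+ x. ennreal (mixed_power p (V x) \<bar>h x\<bar>) \<partial>cube)
      = (\<integral>\<^sup>+ x. \<integral>\<^sup>+ u. ennreal (mixed_power p (V x) \<bar>coord_section k h x u\<bar>) \<partial>unit_measure \<partial>cube)"
    if "h \<in> borel_measurable cube" for h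
  proof -
    have "(\<integral>\<^sup>+ x. ennreal (mixed_power p (V x) \<bar>h x\<bar>) \<partial>cube)
      = (\<integral>\<^sup>+ x. \<integral>\<^sup>+ u. ennreal (mixed_power p (V (x(k := u))) \<bar>h (x(k := u))\<bar>) \<partial>unit_measure \<partial>cube)"
      using k mixed[OF that] by (rule nn_integral_cube_section)
    also have "\<dots> = (\<integral>\<^sup>+ x. \<integral>\<^sup>+ u. ennreal (mixed_power p (V x) \<bar>coord_section k h x u\<bar>) \<partial>unit_measure \<partial>cube)"
      using k coord_algebra_upd_invariant[OF V(1), of k]
      by (intro nn_integral_cong) (auto simp: coord_section_def space_unit_measure)
    finally show ?thesis .
  qed
  \<comment> \<open>Countably many null sets are merged here.\<close>
  have "AE x in cube. \<forall>q\<in>\<rat> \<inter> {0..1}.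
        (\<integral>\<^sup>+ s\<in>{0<..<q}. ennreal (decr_rearrangement unit_measure (coord_section k f x) s) \<partial>lborel)
        \<le> (\<integral>\<^sup>+ s\<in>{0<..<q}. ennreal (decr_rearrangement unit_measure (coord_section k g x) s) \<partial>lborel)"
    using le countable_Int1[OF countable_rat] by (subst AE_ball_countable) blast+
  then have "AE x in cube. (\<integral>\<^sup>+ u. ennreal (mixed_power p (V x) \<bar>coord_section k f x u\<bar>) \<partial>unit_measure)
      \<le> ennreal (mixed_const p) * (\<integral>\<^sup>+ u. ennreal (mixed_power p (V x) \<bar>coord_section k g x u\<bar>) \<partial>unit_measure)"
  proof (rule AE_mp, intro AE_I2 impI)
    fix x assume x: "x \<in> space cube" and *: "\<forall>q\<in>\<rat> \<inter> {0..1}.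
        (\<integral>\<^sup>+ s\<in>{0<..<q}. ennreal (decr_rearrangement unit_measure (coord_section k f x) s) \<partial>lborel)
        \<le> (\<integral>\<^sup>+ s\<in>{0<..<q}. ennreal (decr_rearrangement unit_measure (coord_section k g x) s) \<partial>lborel)"
    have sec: "coord_section k h x \<in> borel_measurable unit_measure" if "h \<in> borel_measurable cube" for h
      unfolding coord_section_def using k x that by (rule measurable_cube_section)
    have q: "(\<integral>\<^sup>+ s\<in>{0<..<q}. ennreal (decr_rearrangement unit_measure (coord_section k f x) s) \<partial>lborel)
        \<le> (\<integral>\<^sup>+ s\<in>{0<..<q}. ennreal (decr_rearrangement unit_measure (coord_section k g x) s) \<partial>lborel)"
      if "q \<in> \<rat>" "q \<in> {0..1}" for q
      using * that by blast
    show "(\<integral>\<^sup>+ u. ennreal (mixed_power p (V x) \<bar>coord_section k f x u\<bar>) \<partial>unit_measure)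
      \<le> ennreal (mixed_const p) * (\<integral>\<^sup>+ u. ennreal (mixed_power p (V x) \<bar>coord_section k g x u\<bar>) \<partial>unit_measure)"
      by (rule U.nn_integral_mixed_power_mono_rearrangement[OF p V(2) sec[OF f] sec[OF g] q])
  qed
  then have "(\<integral>\<^sup>+ x. ennreal (mixed_power p (V x) \<bar>f x\<bar>) \<partial>cube)
      \<le> (\<integral>\<^sup>+ x. ennreal (mixed_const p) * (\<integral>\<^sup>+ u. ennreal (mixed_power p (V x) \<bar>coord_section k g x u\<bar>) \<partial>unit_measure) \<partial>cube)"
    unfolding unfold[OF f] by (rule nn_integral_mono_AE)
  also have "\<dots> = ennreal (mixed_const p) * (\<integral>\<^sup>+ x. ennreal (mixed_power p (V x) \<bar>g x\<bar>) \<partial>cube)"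
    unfolding unfold[OF g]
  proof (rule nn_integral_cmult)
    have [measurable]: "(\<lambda>(u, x). g (x(k := u))) \<in> borel_measurable (unit_measure \<Otimes>\<^sub>M cube)"
      using measurable_compose[OF measurable_cube_upd[OF k] g] by (simp add: case_prod_beta')
    then have [measurable]: "(\<lambda>(x, u). g (x(k := u))) \<in> borel_measurable (cube \<Otimes>\<^sub>M unit_measure)"
      by (subst measurable_pair_swap_iff) (simp add: case_prod_beta')
    show "(\<lambda>x. \<integral>\<^sup>+ u. ennreal (mixed_power p (V x) \<bar>coord_section k g x u\<bar>) \<partial>unit_measure) \<in> borel_measurable cube"
      unfolding coord_section_def mixed_power_def by measurable
  qed
  finally show ?thesis .
qed

section \<open>Elementary inequalities for powers and \<open>mixed_power\<close>\<close>

lemma powr_add_le: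
  fixes a b p :: real
  assumes "0 \<le> a" "0 \<le> b" "0 \<le> p"
  shows "(a + b) powr p \<le> 2 powr p * (a powr p + b powr p)"
proof -
  have "(a + b) powr p \<le> (2 * max a b) powr p"
    using assms by (intro powr_mono2) auto
  also have "\<dots> = 2 powr p * max a b powr p"
    using assms by (simp add: powr_mult)
  also have "\<dots> \<le> 2 powr p * (a powr p + b powr p)"
    by (intro mult_left_mono) (auto simp: max_def)
  finally show ?thesis .
qed

lemma powr_mult_le_add:
  fixes a b p :: real
  assumes "0 \<le> a" "0 \<le> b" "1 \<le> p"
  shows "a powr (p - 1) * b \<le> a powr p + b powr p"
proof -
  have self: "c powr (p - 1) * c = c powr p" if "0 \<le> c" for c :: real
    using that by (cases "c = 0") (simp_all add: powr_diff)
  show ?thesis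
  proof (cases "a \<le> b")
    case True
    then have "a powr (p - 1) * b \<le> b powr (p - 1) * b"
      using assms by (intro mult_right_mono powr_mono2) auto
    then show ?thesis using self[OF assms(2)] by (simp add: add_increasing)
  next
    case False
    then have "a powr (p - 1) * b \<le> a powr (p - 1) * a"
      using assms by (intro mult_left_mono) auto
    then show ?thesis using self[OF assms(1)] by (simp add: add_increasing2)
  qed
qed

lemma mixed_power_le_powr:
  assumes "0 \<le> a" "0 \<le> b"
  shows "mixed_power p a b \<le> (a + b) powr p"
proof -
  have "mixed_power p a b \<le> (a + b) powr (p - 2) * (a + b)\<^sup>2"
    unfolding mixed_power_def using assms by (intro mult_left_mono power_mono) auto
  also have "\<dots> = (a + b) powr p" using assms by (intro powr_mult_sq) auto
  finally show ?thesis .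
qed

lemma mixed_power_zero_left: "0 \<le> b \<Longrightarrow> mixed_power p 0 b = b powr p"
  by (simp add: mixed_power_def powr_mult_sq)

lemma mixed_power_antimono_left:
  assumes "p \<le> 2" "0 \<le> a" "a \<le> a'" "0 \<le> b"
  shows "mixed_power p a' b \<le> mixed_power p a b"
proof (cases "b = 0")
  case False
  then show ?thesis
    unfolding mixed_power_def using assms by (intro mult_right_mono powr_mono2') auto
qed (simp add: mixed_power_def)

text \<open>For \<open>p < 2\<close> the factor \<open>(a + b) powr (p - 2)\<close> decreases in
  \<open>b\<close>. Writing the product as \<open>(b / (a + b)) powr (2 - p) * b powr p\<close>
  makes both factors increasing.\<close>

lemma mixed_power_mono_right:
  assumes "0 \<le> p" "0 \<le> a" "0 \<le> b" "b \<le> c"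
  shows "mixed_power p a b \<le> mixed_power p a c"
proof (cases "2 \<le> p")
  case True
  then show ?thesis
    unfolding mixed_power_def using assms by (intro mult_mono powr_mono2 power_mono) auto
next
  case False
  show ?thesis
  proof (cases "b = 0")
    case False
    have eq: "mixed_power p a b = (b / (a + b)) powr (2 - p) * b powr p" if "0 < b" for b
    proof -
      have "b\<^sup>2 = b powr (2 - p) * b powr p"
        using that by (simp add: powr_numeral flip: powr_add)
      moreover have "(a + b) powr (p - 2) = 1 / (a + b) powr (2 - p)"
        using powr_minus_divide[of "a + b" "2 - p"] by simp
      ultimately show ?thesis
        using that assms by (simp add: mixed_power_def powr_divide)
    qed
    have "b / (a + b) \<le> c / (a + c)"
      using False assms by (simp add: field_simps mult_left_mono)
    then have "(b / (a + b)) powr (2 - p) * b powr p \<le> (c / (a + c)) powr (2 - p) * c powr p"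
      using assms \<open>\<not> 2 \<le> p\<close> by (intro mult_mono powr_mono2) auto
    then show ?thesis using eq False assms by simp
  qed (simp add: mixed_power_def)
qed

text \<open>Since \<open>b + c\<close> is at most twice the maximum, it is enough that doubling the
  second argument costs a factor of at most 4; for \<open>p \<le> 2\<close> only the square
  grows.\<close>

lemma mixed_power_add_right:
  assumes p: "0 \<le> p" "p \<le> 2" and nonneg: "0 \<le> a" "0 \<le> b" "0 \<le> c"
  shows "mixed_power p a (b + c) \<le> 4 * (mixed_power p a b + mixed_power p a c)"
proof -
  have double: "mixed_power p a (2 * c) \<le> 4 * mixed_power p a c" if "0 \<le> c" for c
  proof (cases "c = 0")
    case False
    then have "(a + 2 * c) powr (p - 2) * (2 * c)\<^sup>2 \<le> (a + c) powr (p - 2) * (2 * c)\<^sup>2"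
      using that nonneg p by (intro mult_right_mono powr_mono2') auto
    then show ?thesis by (simp add: mixed_power_def power_mult_distrib)
  qed (simp add: mixed_power_def)
  have "mixed_power p a (b + c) \<le> mixed_power p a (2 * max b c)"
    using p nonneg by (intro mixed_power_mono_right) auto
  also have "\<dots> \<le> 4 * mixed_power p a (max b c)"
    using nonneg by (intro double) auto
  also have "\<dots> \<le> 4 * (mixed_power p a b + mixed_power p a c)"
    by (simp add: max_def)
  finally show ?thesis .
qed

lemma convex_on_abs_powr:
  assumes "1 < p"
  shows "convex_on UNIV (\<lambda>x::real. \<bar>x\<bar> powr p)"
proof (rule convex_on_realI[where f' = "\<lambda>x. p * (sgn x * \<bar>x\<bar> powr (p - 1))"])
  show "((\<lambda>x. \<bar>x\<bar> powr p) has_real_derivative p * (sgn x * \<bar>x\<bar> powr (p - 1))) (at x)" for x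
    using has_real_derivative_abs_powr[OF assms, of x] unfolding mult.assoc abs_powr_minus_two_mult .
  fix x y :: real assume "x \<le> y"
  have "sgn x * \<bar>x\<bar> powr (p - 1) \<le> sgn y * \<bar>y\<bar> powr (p - 1)"
  proof -
    consider "0 \<le> x" | "y \<le> 0" | "x < 0" "0 < y" using \<open>x \<le> y\<close> by linarith
    then show ?thesis
    proof cases
      case 1
      then have "\<bar>x\<bar> powr (p - 1) \<le> \<bar>y\<bar> powr (p - 1)"
        using assms \<open>x \<le> y\<close> by (intro powr_mono2) auto
      then show ?thesis using 1 \<open>x \<le> y\<close> by (auto simp: sgn_if)
    next
      case 2
      then have "\<bar>y\<bar> powr (p - 1) \<le> \<bar>x\<bar> powr (p - 1)"
        using assms \<open>x \<le> y\<close> by (intro powr_mono2) auto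
      then show ?thesis using 2 \<open>x \<le> y\<close> by (auto simp: sgn_if)
    next
      case 3
      have "- (\<bar>x\<bar> powr (p - 1)) \<le> 0" by simp
      also have "0 \<le> \<bar>y\<bar> powr (p - 1)" by simp
      finally show ?thesis using 3 by simp
    qed
  qed
  then show "p * (sgn x * \<bar>x\<bar> powr (p - 1)) \<le> p * (sgn y * \<bar>y\<bar> powr (p - 1))"
    using assms by (intro mult_left_mono) auto
qed auto

section \<open>Increments of a martingale\<close>

lemma integrable_powr_norm_add:
  fixes f g :: "'a \<Rightarrow> 'b::{second_countable_topology, real_normed_vector}"
  assumes [measurable]: "f \<in> borel_measurable M" "g \<in> borel_measurable M" and "0 \<le> p"
    and int: "integrable M (\<lambda>x. norm (f x) powr p)" "integrable M (\<lambda>x. norm (g x) powr p)"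
  shows "integrable M (\<lambda>x. norm (f x + g x) powr p)"
proof (rule Bochner_Integration.integrable_bound)
  show "integrable M (\<lambda>x. 2 powr p * (norm (f x) powr p + norm (g x) powr p))"
    using int by auto
  show "AE x in M. norm (norm (f x + g x) powr p) \<le> norm (2 powr p * (norm (f x) powr p + norm (g x) powr p))"
  proof (intro AE_I2)
    fix x
    have "norm (f x + g x) powr p \<le> (norm (f x) + norm (g x)) powr p"
      using \<open>0 \<le> p\<close> by (intro powr_mono2 norm_triangle_ineq) auto
    also have "\<dots> \<le> 2 powr p * (norm (f x) powr p + norm (g x) powr p)"
      using \<open>0 \<le> p\<close> by (intro powr_add_le) auto
    finally show "norm (norm (f x + g x) powr p) \<le> norm (2 powr p * (norm (f x) powr p + norm (g x) powr p))"
      by simp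
  qed
qed measurable

lemma integrable_mixed_power:
  fixes f :: "'a \<Rightarrow> 'b::{second_countable_topology, real_normed_vector}"
    and g :: "'a \<Rightarrow> 'c::{second_countable_topology, real_normed_vector}"
  assumes [measurable]: "f \<in> borel_measurable M" "g \<in> borel_measurable M" and "0 \<le> p"
    and int: "integrable M (\<lambda>x. norm (f x) powr p)" "integrable M (\<lambda>x. norm (g x) powr p)"
  shows "integrable M (\<lambda>x. mixed_power p (norm (f x)) (norm (g x)))"
proof (rule Bochner_Integration.integrable_bound)
  show "integrable M (\<lambda>x. 2 powr p * (norm (f x) powr p + norm (g x) powr p))"
    using int by auto
  show "(\<lambda>x. mixed_power p (norm (f x)) (norm (g x))) \<in> borel_measurable M"
    unfolding mixed_power_def by measurable
  show "AE x in M. norm (mixed_power p (norm (f x)) (norm (g x))) \<le> norm (2 powr p * (norm (f x) powr p + norm (g x) powr p))"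
  proof (intro AE_I2)
    fix x
    have "mixed_power p (norm (f x)) (norm (g x)) \<le> (norm (f x) + norm (g x)) powr p"
      by (intro mixed_power_le_powr) auto
    also have "\<dots> \<le> 2 powr p * (norm (f x) powr p + norm (g x) powr p)"
      using \<open>0 \<le> p\<close> by (intro powr_add_le) auto
    finally show "norm (mixed_power p (norm (f x)) (norm (g x))) \<le> norm (2 powr p * (norm (f x) powr p + norm (g x) powr p))"
      by simp
  qed
qed

text \<open>This controls the linear term of \<open>bregman\<close>: \<open>h\<close> is meant as a
  component of \<open>f\<close>, and the product is at most
  \<open>norm (f x) powr (p - 1) * |g x|\<close>, hence at most the sum of the p-th powers.\<close>

lemma integrable_powr_norm_mult:
  fixes f :: "'a \<Rightarrow> 'b::{second_countable_topology, real_normed_vector}"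
    and g :: "'a \<Rightarrow> real"
  assumes [measurable]: "f \<in> borel_measurable M" "g \<in> borel_measurable M" "h \<in> borel_measurable M" and "1 \<le> p"
    and int: "integrable M (\<lambda>x. norm (f x) powr p)" "integrable M (\<lambda>x. \<bar>g x\<bar> powr p)"
    and h: "\<And>x. \<bar>h x\<bar> \<le> norm (f x)"
  shows "integrable M (\<lambda>x. norm (f x) powr (p - 2) * h x * g x)"
proof (rule Bochner_Integration.integrable_bound)
  show "integrable M (\<lambda>x. norm (f x) powr p + \<bar>g x\<bar> powr p)"
    using int by auto
  show "AE x in M. norm (norm (f x) powr (p - 2) * h x * g x) \<le> norm (norm (f x) powr p + \<bar>g x\<bar> powr p)"
  proof (intro AE_I2)
    fix x
    have "norm (norm (f x) powr (p - 2) * h x * g x) \<le> norm (f x) powr (p - 2) * norm (f x) * \<bar>g x\<bar>"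
      using h[of x] by (simp add: abs_mult mult_left_mono mult_right_mono)
    also have "norm (f x) powr (p - 2) * norm (f x) = norm (f x) powr (p - 1)"
    proof (cases "f x = 0")
      case False
      then show ?thesis using powr_add[of "norm (f x)" "p - 2" 1] by simp
    qed simp
    also have "norm (f x) powr (p - 1) * \<bar>g x\<bar> \<le> norm (f x) powr p + \<bar>g x\<bar> powr p"
      using \<open>1 \<le> p\<close> by (intro powr_mult_le_add) auto
    finally show "norm (norm (f x) powr (p - 2) * h x * g x) \<le> norm (norm (f x) powr p + \<bar>g x\<bar> powr p)"
      by simp
  qed
qed measurable

lemma integral_bregman:
  fixes Z W :: "'a \<Rightarrow> 'b::{second_countable_topology, real_inner}"
  assumes [measurable]: "Z \<in> borel_measurable M" "W \<in> borel_measurable M" and "1 \<le> p"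
    and int: "integrable M (\<lambda>x. norm (Z x) powr p)" "integrable M (\<lambda>x. norm (W x) powr p)"
    and inner: "integrable M (\<lambda>x. norm (Z x) powr (p - 2) * inner (Z x) (W x))"
      "(\<integral>x. norm (Z x) powr (p - 2) * inner (Z x) (W x) \<partial>M) = 0"
  shows "integrable M (\<lambda>x. bregman p (Z x) (W x))"
    "(\<integral>x. bregman p (Z x) (W x) \<partial>M) = (\<integral>x. norm (Z x + W x) powr p \<partial>M) - (\<integral>x. norm (Z x) powr p \<partial>M)"
proof -
  have *: "integrable M (\<lambda>x. norm (Z x + W x) powr p)"
    using assms by (intro integrable_powr_norm_add) auto
  have eq: "bregman p (Z x) (W x) = (norm (Z x + W x) powr p - norm (Z x) powr p)
      - p * (norm (Z x) powr (p - 2) * inner (Z x) (W x))" for x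
    by (simp add: bregman_def mult.assoc)
  show "integrable M (\<lambda>x. bregman p (Z x) (W x))"
    unfolding eq by (intro Bochner_Integration.integrable_diff integrable_mult_right * int inner)
  show "(\<integral>x. bregman p (Z x) (W x) \<partial>M) = (\<integral>x. norm (Z x + W x) powr p \<partial>M) - (\<integral>x. norm (Z x) powr p \<partial>M)"
    unfolding eq
    by (subst Bochner_Integration.integral_diff Bochner_Integration.integral_mult_right,
        (intro Bochner_Integration.integrable_diff integrable_mult_right * int inner)+)+ (simp add: inner)
qed

context sigma_finite_subalgebra
begin

lemma integral_mult_cond_exp_zero:
  assumes "AE x in M. real_cond_exp M F d x = 0"
    and "V \<in> borel_measurable F" "d \<in> borel_measurable M" "integrable M (\<lambda>x. V x * d x)"
  shows "(\<integral>x. V x * d x \<partial>M) = 0"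
proof -
  have [measurable]: "V \<in> borel_measurable M"
    using assms(2) subalg by (rule measurable_from_subalg[rotated])
  have "(\<integral>x. V x * d x \<partial>M) = (\<integral>x. V x * real_cond_exp M F d x \<partial>M)"
    using real_cond_exp_intg(2)[OF assms(4,2,3)] by simp
  also have "\<dots> = (\<integral>x. 0 \<partial>M)"
    using assms by (intro integral_cong_AE) auto
  finally show ?thesis by simp
qed

text \<open>The factor in front of \<open>d\<close> is measurable with respect to \<open>F\<close>,
  so it can be taken out of the conditional expectation, which is 0. For scalar \<open>f\<close> one
  takes \<open>h = f\<close>, for a pair one of its components.\<close>

lemma orthogonal_powr_norm:
  fixes f :: "'a \<Rightarrow> 'b::{second_countable_topology, real_normed_vector}"
  assumes cond: "AE x in M. real_cond_exp M F d x = 0" and d: "d \<in> borel_measurable M"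
    and f: "f \<in> borel_measurable F" and h: "h \<in> borel_measurable F" "\<And>x. \<bar>h x\<bar> \<le> norm (f x)" and "1 \<le> p"
    and int: "integrable M (\<lambda>x. norm (f x) powr p)" "integrable M (\<lambda>x. \<bar>d x\<bar> powr p)"
  shows "integrable M (\<lambda>x. norm (f x) powr (p - 2) * h x * d x)"
    "(\<integral>x. norm (f x) powr (p - 2) * h x * d x \<partial>M) = 0"
proof -
  show int': "integrable M (\<lambda>x. norm (f x) powr (p - 2) * h x * d x)"
    by (rule integrable_powr_norm_mult[OF measurable_from_subalg[OF subalg f] d
          measurable_from_subalg[OF subalg h(1)] \<open>1 \<le> p\<close> int h(2)])
  show "(\<integral>x. norm (f x) powr (p - 2) * h x * d x \<partial>M) = 0"
  proof (rule integral_mult_cond_exp_zero[OF cond _ d int'])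
    note [measurable] = f h(1)
    show "(\<lambda>x. norm (f x) powr (p - 2) * h x) \<in> borel_measurable F" by measurable
  qed
qed

lemma integral_bregman_real:
  fixes X d :: "'a \<Rightarrow> real"
  assumes cond: "AE x in M. real_cond_exp M F d x = 0" and d: "d \<in> borel_measurable M"
    and X: "X \<in> borel_measurable F" and "1 \<le> p"
    and int: "integrable M (\<lambda>x. \<bar>X x\<bar> powr p)" "integrable M (\<lambda>x. \<bar>d x\<bar> powr p)"
  shows "integrable M (\<lambda>x. bregman p (X x) (d x))"
    "(\<integral>x. bregman p (X x) (d x) \<partial>M) = (\<integral>x. \<bar>X x + d x\<bar> powr p \<partial>M) - (\<integral>x. \<bar>X x\<bar> powr p \<partial>M)"
proof -
  note orth = orthogonal_powr_norm[of d X X p, OF cond d X X _ \<open>1 \<le> p\<close>]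
  have 1: "integrable M (\<lambda>x. norm (X x) powr (p - 2) * inner (X x) (d x))"
    "(\<integral>x. norm (X x) powr (p - 2) * inner (X x) (d x) \<partial>M) = 0"
    using orth int by (simp_all add: mult.assoc)
  note integral_bregman[OF measurable_from_subalg[OF subalg X] d \<open>1 \<le> p\<close> _ _ 1]
  from this int show "integrable M (\<lambda>x. bregman p (X x) (d x))"
    "(\<integral>x. bregman p (X x) (d x) \<partial>M) = (\<integral>x. \<bar>X x + d x\<bar> powr p \<partial>M) - (\<integral>x. \<bar>X x\<bar> powr p \<partial>M)"
    by simp_all
qed

text \<open>The inner product of the pairs splits into one term with \<open>d\<close> and one with
  \<open>e\<close>; each is orthogonal by \<open>orthogonal_powr_norm\<close>. No relation between
  \<open>d\<close> and \<open>e\<close> enters.\<close>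

lemma integral_bregman_pair:
  fixes X Y d e :: "'a \<Rightarrow> real"
  assumes cond: "AE x in M. real_cond_exp M F d x = 0" "AE x in M. real_cond_exp M F e x = 0"
    and meas: "d \<in> borel_measurable M" "e \<in> borel_measurable M"
    and XY: "X \<in> borel_measurable F" "Y \<in> borel_measurable F" and "1 \<le> p"
    and int: "integrable M (\<lambda>x. norm (X x, Y x) powr p)"
      "integrable M (\<lambda>x. \<bar>d x\<bar> powr p)" "integrable M (\<lambda>x. \<bar>e x\<bar> powr p)"
  shows "integrable M (\<lambda>x. bregman p (X x, Y x) (d x, e x))"
    "(\<integral>x. bregman p (X x, Y x) (d x, e x) \<partial>M)
      = (\<integral>x. norm (X x + d x, Y x + e x) powr p \<partial>M) - (\<integral>x. norm (X x, Y x) powr p \<partial>M)"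
proof -
  have Z: "(\<lambda>x. (X x, Y x)) \<in> borel_measurable F" using XY by (rule borel_measurable_Pair)
  have le: "\<bar>X x\<bar> \<le> norm (X x, Y x)" "\<bar>Y x\<bar> \<le> norm (X x, Y x)" for x
    using norm_fst_le[of "X x" "Y x"] norm_snd_le[of "Y x" "X x"] by simp_all
  note orth = orthogonal_powr_norm[OF cond(1) meas(1) Z XY(1) le(1) \<open>1 \<le> p\<close> int(1,2)]
    orthogonal_powr_norm[OF cond(2) meas(2) Z XY(2) le(2) \<open>1 \<le> p\<close> int(1,3)]
  have eq: "norm (X x, Y x) powr (p - 2) * inner (X x, Y x) (d x, e x)
      = norm (X x, Y x) powr (p - 2) * X x * d x + norm (X x, Y x) powr (p - 2) * Y x * e x" for x
    by (simp add: inner_prod_def distrib_left mult.assoc)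
  have 1: "integrable M (\<lambda>x. norm (X x, Y x) powr (p - 2) * inner (X x, Y x) (d x, e x))"
    unfolding eq using orth by (intro Bochner_Integration.integrable_add)
  have 2: "(\<integral>x. norm (X x, Y x) powr (p - 2) * inner (X x, Y x) (d x, e x) \<partial>M) = 0"
    unfolding eq using orth by simp
  have [measurable]: "d \<in> borel_measurable M" "e \<in> borel_measurable M" by fact+
  have "integrable M (\<lambda>x. norm ((d x, 0) + (0, e x)) powr p)"
    using int \<open>1 \<le> p\<close> by (intro integrable_powr_norm_add borel_measurable_Pair) auto
  then have W: "integrable M (\<lambda>x. norm (d x, e x) powr p)" by simp
  note 3 = integral_bregman[OF measurable_from_subalg[OF subalg Z] borel_measurable_Pair[OF meas] \<open>1 \<le> p\<close> int(1) W 1 2]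
  show "integrable M (\<lambda>x. bregman p (X x, Y x) (d x, e x))" by (rule 3)
  show "(\<integral>x. bregman p (X x, Y x) (d x, e x) \<partial>M)
      = (\<integral>x. norm (X x + d x, Y x + e x) powr p \<partial>M) - (\<integral>x. norm (X x, Y x) powr p \<partial>M)"
    using 3(2) by simp
qed

end

section \<open>Partial sums of martingale differences on the cube\<close>

interpretation cube: prob_space cube
  by (rule prob_space_cube)

interpretation coord: sigma_finite_subalgebra cube "coord_algebra k" for k
  by (intro finite_measure_subalgebra_is_sigma_finite finite_measure_subalgebra.intro
      finite_measure_subalgebra_axioms.intro cube.finite_measure_axioms subalgebra_coord_algebra)

definition partial_sum :: "(nat \<Rightarrow> 'a \<Rightarrow> real) \<Rightarrow> nat \<Rightarrow> 'a \<Rightarrow> real" where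
  "partial_sum f n x = (\<Sum>k=1..n. f k x)"

lemma partial_sum_0 [simp]: "partial_sum f 0 x = 0"
  and partial_sum_Suc [simp]: "partial_sum f (Suc n) x = partial_sum f n x + f (Suc n) x"
  by (simp_all add: partial_sum_def)

context
  fixes f :: "nat \<Rightarrow> (nat \<Rightarrow> real) \<Rightarrow> real"
  assumes mds: "martingale_difference_seq cube coord_algebra f"
begin

lemma mds_integrable: "1 \<le> k \<Longrightarrow> integrable cube (f k)"
  and mds_adapted: "1 \<le> k \<Longrightarrow> f k \<in> borel_measurable (coord_algebra k)"
  and mds_cond_exp: "AE x in cube. real_cond_exp cube (coord_algebra k) (f (Suc k)) x = 0"
  using mds unfolding martingale_difference_seq_def by (auto dest: spec[of _ "Suc k"])

lemma mds_measurable: "1 \<le> k \<Longrightarrow> f k \<in> borel_measurable cube"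
  using mds_integrable by (rule borel_measurable_integrable)

lemma partial_sum_adapted: "partial_sum f k \<in> borel_measurable (coord_algebra k)"
  unfolding partial_sum_def
  by (intro borel_measurable_sum measurable_coord_algebra_mono[OF mds_adapted]) auto

lemma partial_sum_measurable: "partial_sum f k \<in> borel_measurable cube"
  by (rule measurable_from_subalg[OF subalgebra_coord_algebra partial_sum_adapted])

lemma partial_sum_integrable: "integrable cube (partial_sum f k)"
  unfolding partial_sum_def by (intro Bochner_Integration.integrable_sum mds_integrable) auto

lemma cond_exp_partial_sum:
  "AE x in cube. real_cond_exp cube (coord_algebra k) (partial_sum f (Suc k)) x = partial_sum f k x"
proof -
  have "AE x in cube. real_cond_exp cube (coord_algebra k) (\<lambda>x. partial_sum f k x + f (Suc k) x) x
      = real_cond_exp cube (coord_algebra k) (partial_sum f k) x + real_cond_exp cube (coord_algebra k) (f (Suc k)) x"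
    by (intro coord.real_cond_exp_add partial_sum_integrable mds_integrable) auto
  moreover have "AE x in cube. real_cond_exp cube (coord_algebra k) (partial_sum f k) x = partial_sum f k x"
    by (intro coord.real_cond_exp_F_meas partial_sum_integrable partial_sum_adapted)
  moreover have "partial_sum f (Suc k) = (\<lambda>x. partial_sum f k x + f (Suc k) x)"
    by (auto simp: fun_eq_iff)
  ultimately show ?thesis using mds_cond_exp[of k] by auto
qed

text \<open>Descending induction from \<open>n\<close>: each partial sum is the conditional
  expectation of the next one, and conditional Jensen for the convex function
  \<open>|x| powr p\<close> preserves integrability.\<close>

lemma partial_sum_powr_integrable:
  assumes p: "1 < p" and int: "integrable cube (\<lambda>x. \<bar>partial_sum f n x\<bar> powr p)" and "k \<le> n"
  shows "integrable cube (\<lambda>x. \<bar>partial_sum f k x\<bar> powr p)"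
  using \<open>k \<le> n\<close>
proof (induction k rule: inc_induct)
  case (step k)
  have [measurable]: "partial_sum f k \<in> borel_measurable cube" by (rule partial_sum_measurable)
  have "integrable cube (\<lambda>x. \<bar>real_cond_exp cube (coord_algebra k) (partial_sum f (Suc k)) x\<bar> powr p)"
  proof (rule coord.integrable_convex_cond_exp[where I = UNIV and q = "\<lambda>x. \<bar>x\<bar> powr p"])
    show "(\<lambda>x::real. \<bar>x\<bar> powr p) \<in> borel_measurable borel" by measurable
  qed (use step.IH partial_sum_integrable[of "Suc k"] convex_on_abs_powr[OF p] in auto)
  then show ?case
    by (rule Bochner_Integration.integrable_bound) (use cond_exp_partial_sum[of k] in auto)
qed (rule int)

lemma mds_powr_integrable:
  assumes p: "1 < p" and int: "integrable cube (\<lambda>x. \<bar>partial_sum f n x\<bar> powr p)" and "Suc k \<le> n"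
  shows "integrable cube (\<lambda>x. \<bar>f (Suc k) x\<bar> powr p)"
proof -
  have "integrable cube (\<lambda>x. norm (partial_sum f (Suc k) x + - partial_sum f k x) powr p)"
    using partial_sum_powr_integrable[OF p int, of "Suc k"] partial_sum_powr_integrable[OF p int, of k] assms
      partial_sum_measurable[of k] mds_measurable[of "Suc k"]
    by (intro integrable_powr_norm_add) auto
  then show ?thesis by simp
qed

end

text \<open>In order, the factors come from \<open>bregman_le\<close>, from
  \<open>mixed_power_add_right\<close>, from trading \<open>e\<close> for \<open>d\<close>, and from
  inverting \<open>bregman_real_ge\<close>.\<close>

definition low_const :: "real \<Rightarrow> real" where
  "low_const p = (2 powr p + p) * 2 powr (2 - p) * 4 * (1 + mixed_const p) * (2 / (p * (p - 1)))"

lemma low_const_nonneg: "1 < p \<Longrightarrow> 0 \<le> low_const p"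
  unfolding low_const_def using mixed_const_pos[of p]
  by (intro mult_nonneg_nonneg add_nonneg_nonneg divide_nonneg_nonneg) auto

text \<open>The factors come from \<open>bregman_real_le\<close>, from trading \<open>e\<close> for
  \<open>d\<close>, and from inverting \<open>bregman_ge\<close>.\<close>

definition high_const :: "real \<Rightarrow> real" where
  "high_const p = p * (p - 1) / 2 * (mixed_const p * 16 powr p)"

lemma high_const_nonneg: "1 < p \<Longrightarrow> 0 \<le> high_const p"
  unfolding high_const_def using mixed_const_pos[of p] by (intro mult_nonneg_nonneg) auto

text \<open>The assumption \<open>int\<close> singles out the substantial case: if it fails, the
  right-hand side of the final inequality is infinite.\<close>

locale dominated_mds =
  fixes p :: real and d e :: "nat \<Rightarrow> (nat \<Rightarrow> real) \<Rightarrow> real" and n :: nat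
  assumes p: "1 < p"
    and mds_d: "martingale_difference_seq cube coord_algebra d"
    and mds_e: "martingale_difference_seq cube coord_algebra e"
    and dominated: "\<And>k t. 1 \<le> k \<Longrightarrow> t \<in> {0..1} \<Longrightarrow> AE x in cube.
        (\<integral>\<^sup>+ s\<in>{0<..<t}. ennreal (decr_rearrangement unit_measure (coord_section k (e k) x) s) \<partial>lborel)
        \<le> (\<integral>\<^sup>+ s\<in>{0<..<t}. ennreal (decr_rearrangement unit_measure (coord_section k (d k) x) s) \<partial>lborel)"
    and int: "integrable cube (\<lambda>x. \<bar>partial_sum d n x\<bar> powr p)"
begin

section \<open>Integrability and one-step remainders for a dominated pair\<close>

lemma p_ge_1: "1 \<le> p"
  using p by simp

lemma measurable_cube [measurable]:
  "d (Suc k) \<in> borel_measurable cube" "e (Suc k) \<in> borel_measurable cube"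
  "partial_sum d k \<in> borel_measurable cube" "partial_sum e k \<in> borel_measurable cube"
  using mds_measurable[OF mds_d, of "Suc k"] mds_measurable[OF mds_e, of "Suc k"]
    partial_sum_measurable[OF mds_d] partial_sum_measurable[OF mds_e] by auto

lemma X_powr: "k \<le> n \<Longrightarrow> integrable cube (\<lambda>x. \<bar>partial_sum d k x\<bar> powr p)"
  by (rule partial_sum_powr_integrable[OF mds_d p int])

lemma d_powr: "k < n \<Longrightarrow> integrable cube (\<lambda>x. \<bar>d (Suc k) x\<bar> powr p)"
  using mds_powr_integrable[OF mds_d p int, of k] by simp

text \<open>For \<open>V = 0\<close> the function \<open>mixed_power\<close> is the p-th power, so
  the comparison carries finite p-th moments over from \<open>d\<close> to \<open>e\<close>.\<close>

lemma e_powr: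
  assumes "k < n"
  shows "integrable cube (\<lambda>x. \<bar>e (Suc k) x\<bar> powr p)"
proof (rule integrableI_bounded)
  have "(\<integral>\<^sup>+ x. ennreal (mixed_power p 0 \<bar>e (Suc k) x\<bar>) \<partial>cube)
      \<le> ennreal (mixed_const p) * (\<integral>\<^sup>+ x. ennreal (mixed_power p 0 \<bar>d (Suc k) x\<bar>) \<partial>cube)"
    by (rule nn_integral_mixed_power_section_le[OF p, where k = "Suc k" and V = "\<lambda>_. 0"])
      (auto intro!: dominated)
  also have "\<dots> < \<infinity>"
    using d_powr[OF assms]
    by (auto simp: mixed_power_zero_left integrable_iff_bounded ennreal_mult_less_top)
  finally show "(\<integral>\<^sup>+ x. ennreal (norm (\<bar>e (Suc k) x\<bar> powr p)) \<partial>cube) < \<infinity>"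
    by (simp add: mixed_power_zero_left)
qed measurable

lemma Y_powr: "k \<le> n \<Longrightarrow> integrable cube (\<lambda>x. \<bar>partial_sum e k x\<bar> powr p)"
proof (induction k)
  case (Suc k)
  then have "integrable cube (\<lambda>x. norm (partial_sum e k x + e (Suc k) x) powr p)"
    using e_powr[of k] p by (intro integrable_powr_norm_add) auto
  then show ?case by simp
qed simp

lemma pair_powr:
  assumes "k \<le> n"
  shows "integrable cube (\<lambda>x. norm (c * partial_sum d k x, partial_sum e k x) powr p)"
proof -
  have "integrable cube (\<lambda>x. \<bar>c\<bar> powr p * \<bar>partial_sum d k x\<bar> powr p)"
    using X_powr[OF assms] by simp
  then have "integrable cube (\<lambda>x. norm ((c * partial_sum d k x, 0) + (0, partial_sum e k x)) powr p)"
    using Y_powr[OF assms] p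
    by (intro integrable_powr_norm_add borel_measurable_Pair) (auto simp: abs_mult powr_mult)
  then show ?thesis by simp
qed

lemma bregman_X:
  assumes "k < n"
  shows "integrable cube (\<lambda>x. bregman p (partial_sum d k x) (d (Suc k) x))"
    "(\<integral>x. bregman p (partial_sum d k x) (d (Suc k) x) \<partial>cube)
      = (\<integral>x. \<bar>partial_sum d (Suc k) x\<bar> powr p \<partial>cube) - (\<integral>x. \<bar>partial_sum d k x\<bar> powr p \<partial>cube)"
  using coord.integral_bregman_real[OF mds_cond_exp[OF mds_d, of k] measurable_cube(1)
      partial_sum_adapted[OF mds_d] p_ge_1 X_powr d_powr] assms by simp_all

lemma bregman_Y:
  assumes "k < n"
  shows "integrable cube (\<lambda>x. bregman p (partial_sum e k x) (e (Suc k) x))"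
    "(\<integral>x. bregman p (partial_sum e k x) (e (Suc k) x) \<partial>cube)
      = (\<integral>x. \<bar>partial_sum e (Suc k) x\<bar> powr p \<partial>cube) - (\<integral>x. \<bar>partial_sum e k x\<bar> powr p \<partial>cube)"
  using coord.integral_bregman_real[OF mds_cond_exp[OF mds_e, of k] measurable_cube(2)
      partial_sum_adapted[OF mds_e] p_ge_1 Y_powr e_powr] assms by simp_all

text \<open>The weight \<open>c\<close> on the first component is 1 in the range
  \<open>p \<le> 2\<close> and large in the range \<open>2 \<le> p\<close>.\<close>

lemma bregman_pair:
  fixes c :: real
  assumes "k < n"
  defines "Z \<equiv> \<lambda>k x. (c * partial_sum d k x, partial_sum e k x)"
    and "W \<equiv> \<lambda>x. (c * d (Suc k) x, e (Suc k) x)"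
  shows "integrable cube (\<lambda>x. bregman p (Z k x) (W x))"
    "(\<integral>x. bregman p (Z k x) (W x) \<partial>cube)
      = (\<integral>x. norm (Z (Suc k) x) powr p \<partial>cube) - (\<integral>x. norm (Z k x) powr p \<partial>cube)"
proof -
  have "AE x in cube. real_cond_exp cube (coord_algebra k) (\<lambda>x. c * d (Suc k) x) x
      = c * real_cond_exp cube (coord_algebra k) (d (Suc k)) x"
    by (intro coord.real_cond_exp_cmult mds_integrable[OF mds_d]) simp
  then have cond: "AE x in cube. real_cond_exp cube (coord_algebra k) (\<lambda>x. c * d (Suc k) x) x = 0"
    using mds_cond_exp[OF mds_d, of k] by auto
  have adapted: "(\<lambda>x. c * partial_sum d k x) \<in> borel_measurable (coord_algebra k)"
    using partial_sum_adapted[OF mds_d] by measurable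
  have int_d: "integrable cube (\<lambda>x. \<bar>c * d (Suc k) x\<bar> powr p)"
    using d_powr[OF assms(1)] by (simp add: abs_mult powr_mult)
  note * = coord.integral_bregman_pair[OF cond mds_cond_exp[OF mds_e] _ measurable_cube(2) adapted
      partial_sum_adapted[OF mds_e] p_ge_1 pair_powr int_d e_powr]
  show "integrable cube (\<lambda>x. bregman p (Z k x) (W x))"
    unfolding Z_def W_def using assms(1) by (intro *) auto
  have "(\<integral>x. bregman p (Z k x) (W x) \<partial>cube)
      = (\<integral>x. norm (c * partial_sum d k x + c * d (Suc k) x, partial_sum e k x + e (Suc k) x) powr p \<partial>cube)
        - (\<integral>x. norm (Z k x) powr p \<partial>cube)"
    unfolding Z_def W_def using assms(1) by (intro *) auto
  then show "(\<integral>x. bregman p (Z k x) (W x) \<partial>cube)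
      = (\<integral>x. norm (Z (Suc k) x) powr p \<partial>cube) - (\<integral>x. norm (Z k x) powr p \<partial>cube)"
    by (simp add: Z_def distrib_left)
qed

lemma integral_mixed_power_le:
  fixes V :: "_ \<Rightarrow> 'b::{second_countable_topology, real_normed_vector}"
  assumes k: "k < n" and V: "V \<in> borel_measurable (coord_algebra k)"
    and intV: "integrable cube (\<lambda>x. norm (V x) powr p)"
  shows "integrable cube (\<lambda>x. mixed_power p (norm (V x)) \<bar>d (Suc k) x\<bar>)"
    "integrable cube (\<lambda>x. mixed_power p (norm (V x)) \<bar>e (Suc k) x\<bar>)"
    "(\<integral>x. mixed_power p (norm (V x)) \<bar>e (Suc k) x\<bar> \<partial>cube)
      \<le> mixed_const p * (\<integral>x. mixed_power p (norm (V x)) \<bar>d (Suc k) x\<bar> \<partial>cube)"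
proof -
  have [measurable]: "V \<in> borel_measurable cube"
    by (rule measurable_from_subalg[OF subalgebra_coord_algebra V])
  show d: "integrable cube (\<lambda>x. mixed_power p (norm (V x)) \<bar>d (Suc k) x\<bar>)"
    using integrable_mixed_power[of V cube "d (Suc k)" p] intV d_powr[OF k] p by simp
  show e: "integrable cube (\<lambda>x. mixed_power p (norm (V x)) \<bar>e (Suc k) x\<bar>)"
    using integrable_mixed_power[of V cube "e (Suc k)" p] intV e_powr[OF k] p by simp
  have "(\<integral>\<^sup>+ x. ennreal (mixed_power p (norm (V x)) \<bar>e (Suc k) x\<bar>) \<partial>cube)
      \<le> ennreal (mixed_const p) * (\<integral>\<^sup>+ x. ennreal (mixed_power p (norm (V x)) \<bar>d (Suc k) x\<bar>) \<partial>cube)"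
  proof (rule nn_integral_mixed_power_section_le[OF p, where k = "Suc k" and V = "\<lambda>x. norm (V x)"])
    show "(\<lambda>x. norm (V x)) \<in> borel_measurable (coord_algebra (Suc k - 1))"
      using V by simp
  qed (auto intro!: dominated)
  also have "(\<integral>\<^sup>+ x. ennreal (mixed_power p (norm (V x)) \<bar>e (Suc k) x\<bar>) \<partial>cube)
      = ennreal (\<integral>x. mixed_power p (norm (V x)) \<bar>e (Suc k) x\<bar> \<partial>cube)"
    by (rule nn_integral_eq_integral[OF e]) simp
  also have "(\<integral>\<^sup>+ x. ennreal (mixed_power p (norm (V x)) \<bar>d (Suc k) x\<bar>) \<partial>cube)
      = ennreal (\<integral>x. mixed_power p (norm (V x)) \<bar>d (Suc k) x\<bar> \<partial>cube)"
    by (rule nn_integral_eq_integral[OF d]) simp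
  finally show "(\<integral>x. mixed_power p (norm (V x)) \<bar>e (Suc k) x\<bar> \<partial>cube)
      \<le> mixed_const p * (\<integral>x. mixed_power p (norm (V x)) \<bar>d (Suc k) x\<bar> \<partial>cube)"
    using mixed_const_pos[OF p]
    by (subst (asm) ennreal_mult[symmetric]) (auto simp: ennreal_le_iff)
qed

text \<open>The norm of the pair \<open>Z\<close> serves as first argument of
  \<open>mixed_power\<close> for both differences: it is known at time \<open>k\<close>, so
  \<open>e\<close> can be traded for \<open>d\<close>, and it dominates the partial sum of
  \<open>d\<close>, so the result is bounded by the scalar remainder.\<close>

lemma increment_le_low:
  assumes k: "k < n" and "p \<le> 2"
  defines "Z \<equiv> \<lambda>k x. (partial_sum d k x, partial_sum e k x)"
  shows "(\<integral>x. norm (Z (Suc k) x) powr p \<partial>cube) - (\<integral>x. norm (Z k x) powr p \<partial>cube)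
    \<le> low_const p * ((\<integral>x. \<bar>partial_sum d (Suc k) x\<bar> powr p \<partial>cube) - (\<integral>x. \<bar>partial_sum d k x\<bar> powr p \<partial>cube))"
proof -
  define W where "W x = (d (Suc k) x, e (Suc k) x)" for x
  define C where "C = (2 powr p + p) * 2 powr (2 - p)"
  have C: "0 \<le> C" unfolding C_def using p by (intro mult_nonneg_nonneg add_nonneg_nonneg) auto
  have intZ: "integrable cube (\<lambda>x. norm (Z k x) powr p)"
    using pair_powr[of k 1] k by (simp add: Z_def)
  have Z: "Z k \<in> borel_measurable (coord_algebra k)"
    unfolding Z_def by (intro borel_measurable_Pair partial_sum_adapted mds_d mds_e)
  note mixed_Z = integral_mixed_power_le[OF k Z intZ]
  have mixed_X: "integrable cube (\<lambda>x. mixed_power p \<bar>partial_sum d k x\<bar> \<bar>d (Suc k) x\<bar>)"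
    using integral_mixed_power_le(1)[OF k partial_sum_adapted[OF mds_d]] X_powr[of k] k by simp
  have "(\<integral>x. norm (Z (Suc k) x) powr p \<partial>cube) - (\<integral>x. norm (Z k x) powr p \<partial>cube)
      = (\<integral>x. bregman p (Z k x) (W x) \<partial>cube)"
    using bregman_pair(2)[OF k, of 1] by (simp add: Z_def W_def)
  also have "\<dots> \<le> (\<integral>x. C * 4 * (mixed_power p (norm (Z k x)) \<bar>d (Suc k) x\<bar> + mixed_power p (norm (Z k x)) \<bar>e (Suc k) x\<bar>) \<partial>cube)"
  proof (rule integral_mono)
    show "integrable cube (\<lambda>x. bregman p (Z k x) (W x))"
      using bregman_pair(1)[OF k, of 1] by (simp add: Z_def W_def)
    show "integrable cube (\<lambda>x. C * 4 * (mixed_power p (norm (Z k x)) \<bar>d (Suc k) x\<bar> + mixed_power p (norm (Z k x)) \<bar>e (Suc k) x\<bar>))"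
      by (intro integrable_mult_right Bochner_Integration.integrable_add mixed_Z)
    fix x
    have "bregman p (Z k x) (W x) \<le> C * mixed_power p (norm (Z k x)) (norm (W x))"
      unfolding C_def by (rule bregman_le[OF p \<open>p \<le> 2\<close>])
    also have "\<dots> \<le> C * mixed_power p (norm (Z k x)) (\<bar>d (Suc k) x\<bar> + \<bar>e (Suc k) x\<bar>)"
      using C p norm_Pair_le[of "d (Suc k) x" "e (Suc k) x"]
      by (intro mult_left_mono mixed_power_mono_right) (auto simp: W_def)
    also have "\<dots> \<le> C * (4 * (mixed_power p (norm (Z k x)) \<bar>d (Suc k) x\<bar> + mixed_power p (norm (Z k x)) \<bar>e (Suc k) x\<bar>))"
      using C p \<open>p \<le> 2\<close> by (intro mult_left_mono mixed_power_add_right) auto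
    finally show "bregman p (Z k x) (W x) \<le> C * 4 * (mixed_power p (norm (Z k x)) \<bar>d (Suc k) x\<bar> + mixed_power p (norm (Z k x)) \<bar>e (Suc k) x\<bar>)"
      by (simp only: mult.assoc)
  qed
  also have "\<dots> = C * 4 * ((\<integral>x. mixed_power p (norm (Z k x)) \<bar>d (Suc k) x\<bar> \<partial>cube) + (\<integral>x. mixed_power p (norm (Z k x)) \<bar>e (Suc k) x\<bar> \<partial>cube))"
    using mixed_Z by simp
  also have "\<dots> \<le> C * 4 * ((1 + mixed_const p) * (\<integral>x. mixed_power p (norm (Z k x)) \<bar>d (Suc k) x\<bar> \<partial>cube))"
    using C mixed_Z(3) by (intro mult_left_mono) (auto simp: distrib_right)
  also have "\<dots> \<le> C * 4 * ((1 + mixed_const p) * (\<integral>x. 2 / (p * (p - 1)) * bregman p (partial_sum d k x) (d (Suc k) x) \<partial>cube))"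
  proof -
    have "(\<integral>x. mixed_power p (norm (Z k x)) \<bar>d (Suc k) x\<bar> \<partial>cube)
        \<le> (\<integral>x. 2 / (p * (p - 1)) * bregman p (partial_sum d k x) (d (Suc k) x) \<partial>cube)"
    proof (rule integral_mono)
      show "integrable cube (\<lambda>x. mixed_power p (norm (Z k x)) \<bar>d (Suc k) x\<bar>)" by (rule mixed_Z)
      show "integrable cube (\<lambda>x. 2 / (p * (p - 1)) * bregman p (partial_sum d k x) (d (Suc k) x))"
        by (intro integrable_mult_right bregman_X k)
      fix x
      \<comment> \<open>Shrinking the first argument enlarges \<open>mixed_power\<close> because
        \<open>p \<le> 2\<close>.\<close>
      have "mixed_power p (norm (Z k x)) \<bar>d (Suc k) x\<bar> \<le> mixed_power p \<bar>partial_sum d k x\<bar> \<bar>d (Suc k) x\<bar>"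
        using \<open>p \<le> 2\<close> norm_fst_le[of "partial_sum d k x" "partial_sum e k x"]
        by (intro mixed_power_antimono_left) (auto simp: Z_def)
      also have "\<dots> = 2 / (p * (p - 1)) * (p * (p - 1) / 2 * mixed_power p \<bar>partial_sum d k x\<bar> \<bar>d (Suc k) x\<bar>)"
        using p by simp
      also have "\<dots> \<le> 2 / (p * (p - 1)) * bregman p (partial_sum d k x) (d (Suc k) x)"
        using p by (intro mult_left_mono bregman_real_ge \<open>p \<le> 2\<close>) auto
      finally show "mixed_power p (norm (Z k x)) \<bar>d (Suc k) x\<bar> \<le> 2 / (p * (p - 1)) * bregman p (partial_sum d k x) (d (Suc k) x)" .
    qed
    then show ?thesis
      using C mixed_const_pos[OF p] by (intro mult_left_mono) auto
  qed
  also have "\<dots> = low_const p * (\<integral>x. bregman p (partial_sum d k x) (d (Suc k) x) \<partial>cube)"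
    by (simp add: low_const_def C_def)
  finally show ?thesis unfolding bregman_X(2)[OF k] .
qed

text \<open>The increments are summed from the zero sums at time 0; then \<open>|Y|\<close> is
  bounded by the norm of the pair.\<close>

lemma bound_low:
  assumes "p \<le> 2"
  shows "(\<integral>x. \<bar>partial_sum e n x\<bar> powr p \<partial>cube) \<le> low_const p * (\<integral>x. \<bar>partial_sum d n x\<bar> powr p \<partial>cube)"
proof -
  have "(\<integral>x. norm (partial_sum d k x, partial_sum e k x) powr p \<partial>cube)
      \<le> low_const p * (\<integral>x. \<bar>partial_sum d k x\<bar> powr p \<partial>cube)" if "k \<le> n" for k
    using that
  proof (induction k)
    case 0
    then show ?case by simp
  next
    case (Suc k)
    then have "k < n" and IH: "(\<integral>x. norm (partial_sum d k x, partial_sum e k x) powr p \<partial>cube)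
      \<le> low_const p * (\<integral>x. \<bar>partial_sum d k x\<bar> powr p \<partial>cube)" by simp_all
    from increment_le_low[OF \<open>k < n\<close> assms] IH show ?case
      by (simp add: right_diff_distrib del: partial_sum_Suc)
  qed
  moreover have "(\<integral>x. \<bar>partial_sum e n x\<bar> powr p \<partial>cube) \<le> (\<integral>x. norm (partial_sum d n x, partial_sum e n x) powr p \<partial>cube)"
  proof (rule integral_mono)
    show "integrable cube (\<lambda>x. norm (partial_sum d n x, partial_sum e n x) powr p)"
      using pair_powr[of n 1] by simp
    show "\<bar>partial_sum e n x\<bar> powr p \<le> norm (partial_sum d n x, partial_sum e n x) powr p" for x
      using norm_snd_le[of "partial_sum e n x" "partial_sum d n x"] p by (intro powr_mono2) auto
  qed (rule Y_powr, simp)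
  ultimately show ?thesis by (meson order_refl order_trans)
qed

text \<open>After \<open>e\<close> is traded for \<open>d\<close> with \<open>|Y|\<close> as first
  argument, both arguments of \<open>mixed_power\<close> may be enlarged to the norms of
  \<open>Z\<close> and \<open>W\<close>, since \<open>2 \<le> p\<close>. The factor
  \<open>c^2\<close> fits in because \<open>c * |d|\<close> is still at most
  \<open>norm W\<close>.\<close>

lemma increment_le_high:
  assumes k: "k < n" and "2 \<le> p" and c: "1 \<le> c"
  defines "Z \<equiv> \<lambda>k x. (c * partial_sum d k x, partial_sum e k x)"
  shows "c\<^sup>2 * ((\<integral>x. \<bar>partial_sum e (Suc k) x\<bar> powr p \<partial>cube) - (\<integral>x. \<bar>partial_sum e k x\<bar> powr p \<partial>cube))
    \<le> high_const p * ((\<integral>x. norm (Z (Suc k) x) powr p \<partial>cube) - (\<integral>x. norm (Z k x) powr p \<partial>cube))"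
proof -
  define W where "W x = (c * d (Suc k) x, e (Suc k) x)" for x
  have intZ: "integrable cube (\<lambda>x. norm (Z k x) powr p)"
    unfolding Z_def using pair_powr[of k c] k by simp
  have "integrable cube (\<lambda>x. norm (partial_sum e k x) powr p)" using Y_powr[of k] k by simp
  note mixed_Y = integral_mixed_power_le[OF k partial_sum_adapted[OF mds_e] this]
  have "(\<integral>x. \<bar>partial_sum e (Suc k) x\<bar> powr p \<partial>cube) - (\<integral>x. \<bar>partial_sum e k x\<bar> powr p \<partial>cube)
      = (\<integral>x. bregman p (partial_sum e k x) (e (Suc k) x) \<partial>cube)"
    using bregman_Y(2)[OF k] by simp
  also have "\<dots> \<le> (\<integral>x. p * (p - 1) / 2 * mixed_power p (norm (partial_sum e k x)) \<bar>e (Suc k) x\<bar> \<partial>cube)"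
    using bregman_real_le[OF \<open>2 \<le> p\<close>]
    by (intro integral_mono bregman_Y(1) k integrable_mult_right mixed_Y) auto
  also have "\<dots> = p * (p - 1) / 2 * (\<integral>x. mixed_power p (norm (partial_sum e k x)) \<bar>e (Suc k) x\<bar> \<partial>cube)"
    by simp
  also have "\<dots> \<le> p * (p - 1) / 2 * (mixed_const p * (\<integral>x. mixed_power p (norm (partial_sum e k x)) \<bar>d (Suc k) x\<bar> \<partial>cube))"
    using p by (intro mult_left_mono mixed_Y) auto
  finally have "c\<^sup>2 * ((\<integral>x. \<bar>partial_sum e (Suc k) x\<bar> powr p \<partial>cube) - (\<integral>x. \<bar>partial_sum e k x\<bar> powr p \<partial>cube))
      \<le> c\<^sup>2 * (p * (p - 1) / 2 * (mixed_const p * (\<integral>x. mixed_power p (norm (partial_sum e k x)) \<bar>d (Suc k) x\<bar> \<partial>cube)))"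
    by (intro mult_left_mono) auto
  also have "\<dots> = p * (p - 1) / 2 * (mixed_const p * (\<integral>x. c\<^sup>2 * mixed_power p (norm (partial_sum e k x)) \<bar>d (Suc k) x\<bar> \<partial>cube))"
    by simp
  also have "\<dots> \<le> p * (p - 1) / 2 * (mixed_const p * (\<integral>x. 16 powr p * bregman p (Z k x) (W x) \<partial>cube))"
  proof -
    have "(\<integral>x. c\<^sup>2 * mixed_power p (norm (partial_sum e k x)) \<bar>d (Suc k) x\<bar> \<partial>cube)
        \<le> (\<integral>x. 16 powr p * bregman p (Z k x) (W x) \<partial>cube)"
    proof (rule integral_mono)
      show "integrable cube (\<lambda>x. c\<^sup>2 * mixed_power p (norm (partial_sum e k x)) \<bar>d (Suc k) x\<bar>)"
        by (intro integrable_mult_right mixed_Y)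
      show "integrable cube (\<lambda>x. 16 powr p * bregman p (Z k x) (W x))"
        unfolding Z_def W_def by (intro integrable_mult_right bregman_pair k)
      fix x
      have Yx: "norm (partial_sum e k x) \<le> norm (Z k x)"
        unfolding Z_def by (rule norm_snd_le)
      have dx: "c * \<bar>d (Suc k) x\<bar> \<le> norm (W x)"
        using norm_fst_le[of "c * d (Suc k) x" "e (Suc k) x"] c by (simp add: W_def abs_mult)
      have dx': "\<bar>d (Suc k) x\<bar> \<le> norm (W x)"
        using mult_right_mono[OF c, of "\<bar>d (Suc k) x\<bar>"] dx by simp
      have "c\<^sup>2 * mixed_power p (norm (partial_sum e k x)) \<bar>d (Suc k) x\<bar>
          = (norm (partial_sum e k x) + \<bar>d (Suc k) x\<bar>) powr (p - 2) * (c * \<bar>d (Suc k) x\<bar>)\<^sup>2"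
        by (simp add: mixed_power_def power_mult_distrib)
      also have "\<dots> \<le> (norm (Z k x) + norm (W x)) powr (p - 2) * (norm (W x))\<^sup>2"
        using Yx dx dx' c \<open>2 \<le> p\<close> by (intro mult_mono powr_mono2 power_mono add_mono) auto
      also have "\<dots> = 16 powr p * (16 powr (- p) * mixed_power p (norm (Z k x)) (norm (W x)))"
        by (simp add: mixed_power_def powr_minus)
      also have "\<dots> \<le> 16 powr p * bregman p (Z k x) (W x)"
        by (intro mult_left_mono bregman_ge \<open>2 \<le> p\<close>) auto
      finally show "c\<^sup>2 * mixed_power p (norm (partial_sum e k x)) \<bar>d (Suc k) x\<bar> \<le> 16 powr p * bregman p (Z k x) (W x)" .
    qed
    then show ?thesis
      using p mixed_const_pos[OF p] by (intro mult_left_mono) auto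
  qed
  also have "\<dots> = high_const p * (\<integral>x. bregman p (Z k x) (W x) \<partial>cube)"
    by (simp add: high_const_def)
  also have "(\<integral>x. bregman p (Z k x) (W x) \<partial>cube)
      = (\<integral>x. norm (Z (Suc k) x) powr p \<partial>cube) - (\<integral>x. norm (Z k x) powr p \<partial>cube)"
    unfolding Z_def W_def by (rule bregman_pair(2)[OF k])
  finally show ?thesis .
qed

text \<open>Summing the increments gives
  \<open>c^2 * E \<le> C * 2 powr p * (c powr p * D + E)\<close>. The coefficient of
  \<open>E\<close> on the right does not depend on \<open>c\<close>, so a large \<open>c\<close>
  lets it be absorbed on the left.\<close>

lemma bound_high:
  assumes "2 \<le> p"
  shows "(\<integral>x. \<bar>partial_sum e n x\<bar> powr p \<partial>cube)
    \<le> (1 + 2 * high_const p * 2 powr p) powr p * (\<integral>x. \<bar>partial_sum d n x\<bar> powr p \<partial>cube)"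
proof -
  define C where "C = high_const p"
  \<comment> \<open>Chosen so that \<open>C * 2 powr p \<le> c / 2 \<le> c^2 / 2\<close>; the
    summand 1 guarantees \<open>1 \<le> c\<close>.\<close>
  define c where "c = 1 + 2 * C * 2 powr p"
  define D where "D = (\<integral>x. \<bar>partial_sum d n x\<bar> powr p \<partial>cube)"
  define E where "E = (\<integral>x. \<bar>partial_sum e n x\<bar> powr p \<partial>cube)"
  have C: "0 \<le> C" unfolding C_def by (rule high_const_nonneg[OF p])
  then have c: "1 \<le> c" by (simp add: c_def)
  have nonneg: "0 \<le> D" "0 \<le> E" by (simp_all add: D_def E_def)
  have "c\<^sup>2 * (\<integral>x. \<bar>partial_sum e k x\<bar> powr p \<partial>cube)
      \<le> C * (\<integral>x. norm (c * partial_sum d k x, partial_sum e k x) powr p \<partial>cube)" if "k \<le> n" for k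
    using that
  proof (induction k)
    case 0
    then show ?case by simp
  next
    case (Suc k)
    then have "k < n" and IH: "c\<^sup>2 * (\<integral>x. \<bar>partial_sum e k x\<bar> powr p \<partial>cube)
      \<le> C * (\<integral>x. norm (c * partial_sum d k x, partial_sum e k x) powr p \<partial>cube)" by simp_all
    from increment_le_high[OF \<open>k < n\<close> assms c] IH show ?case
      by (simp add: right_diff_distrib C_def del: partial_sum_Suc)
  qed
  then have "c\<^sup>2 * E \<le> C * (\<integral>x. norm (c * partial_sum d n x, partial_sum e n x) powr p \<partial>cube)"
    unfolding E_def by simp
  also have "\<dots> \<le> C * (\<integral>x. 2 powr p * (c powr p * \<bar>partial_sum d n x\<bar> powr p + \<bar>partial_sum e n x\<bar> powr p) \<partial>cube)"
  proof (intro mult_left_mono C integral_mono)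
    show "integrable cube (\<lambda>x. 2 powr p * (c powr p * \<bar>partial_sum d n x\<bar> powr p + \<bar>partial_sum e n x\<bar> powr p))"
      by (intro integrable_mult_right Bochner_Integration.integrable_add int Y_powr) simp
    fix x
    have "norm (c * partial_sum d n x, partial_sum e n x) powr p \<le> (c * \<bar>partial_sum d n x\<bar> + \<bar>partial_sum e n x\<bar>) powr p"
      using norm_Pair_le[of "c * partial_sum d n x" "partial_sum e n x"] c p
      by (intro powr_mono2) (auto simp: abs_mult)
    also have "\<dots> \<le> 2 powr p * ((c * \<bar>partial_sum d n x\<bar>) powr p + \<bar>partial_sum e n x\<bar> powr p)"
      using c p by (intro powr_add_le) auto
    finally show "norm (c * partial_sum d n x, partial_sum e n x) powr p
        \<le> 2 powr p * (c powr p * \<bar>partial_sum d n x\<bar> powr p + \<bar>partial_sum e n x\<bar> powr p)"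
      using c by (simp add: powr_mult)
  qed (simp add: pair_powr)
  also have "\<dots> = C * (2 powr p * (c powr p * D + E))"
    unfolding D_def E_def using int Y_powr[of n] by simp
  finally have main: "c\<^sup>2 * E \<le> C * 2 powr p * (c powr p * D + E)"
    by (simp only: mult.assoc)
  have "2 * (C * 2 powr p) \<le> c" by (simp add: c_def)
  also have "c \<le> c\<^sup>2" using c by (simp add: power2_eq_square)
  finally have le: "C * 2 powr p \<le> c\<^sup>2 / 2" by simp
  have "c\<^sup>2 * E \<le> c\<^sup>2 / 2 * (c powr p * D + E)"
    using main mult_right_mono[OF le, of "c powr p * D + E"] nonneg by simp
  then have "c\<^sup>2 * E \<le> c\<^sup>2 * ((c powr p * D + E) / 2)" by simp
  then have "E \<le> (c powr p * D + E) / 2"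
    using c by (subst (asm) mult_le_cancel_left_pos) auto
  then have "E \<le> c powr p * D" by simp
  then show ?thesis unfolding c_def C_def D_def E_def .
qed

end

text \<open>The quantifier over \<open>t\<close> stands outside \<open>AE\<close>, so the null set
  may depend on \<open>t\<close>. Sections of \<open>d k\<close> and \<open>e k\<close> depend only
  on the first \<open>k - 1\<close> coordinates, so \<open>AE x in cube\<close> is a condition on
  these. The open interval avoids arguments where the rearrangement has no meaning. The constant is
  uniform in \<open>n\<close>.\<close>

theorem theorem3:
  fixes p :: real
  assumes "1 < p"
  shows "\<exists>c::real. c > 0 \<and>
    (\<forall>d e :: nat \<Rightarrow> (nat \<Rightarrow> real) \<Rightarrow> real.
      martingale_difference_seq cube coord_algebra d \<longrightarrow>
      martingale_difference_seq cube coord_algebra e \<longrightarrow>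
      (\<forall>k\<ge>1. \<forall>t\<in>{0..1}. AE x in cube.
        (\<integral>\<^sup>+ s\<in>{0<..<t}. ennreal (decr_rearrangement unit_measure (coord_section k (e k) x) s) \<partial>lborel)
        \<le> (\<integral>\<^sup>+ s\<in>{0<..<t}. ennreal (decr_rearrangement unit_measure (coord_section k (d k) x) s) \<partial>lborel)) \<longrightarrow>
      (\<forall>n\<ge>1. Lp_norm p cube (\<lambda>x. \<Sum>k=1..n. e k x)
              \<le> ennreal c * Lp_norm p cube (\<lambda>x. \<Sum>k=1..n. d k x)))"
proof -
  \<comment> \<open>A sum in place of a maximum serves both ranges of \<open>p\<close>, and the
    summand 1 makes it positive. The final constant is its p-th root.\<close>
  define B where "B = 1 + low_const p + (1 + 2 * high_const p * 2 powr p) powr p"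
  have B: "B > 0" unfolding B_def using low_const_nonneg[OF assms] by (intro add_pos_nonneg) auto
  have bound: "(\<integral>x. \<bar>partial_sum e n x\<bar> powr p \<partial>cube) \<le> B * (\<integral>x. \<bar>partial_sum d n x\<bar> powr p \<partial>cube)"
    if "dominated_mds p d e n" for d e n
  proof -
    interpret dominated_mds p d e n by fact
    have mono: "c * (\<integral>x. \<bar>partial_sum d n x\<bar> powr p \<partial>cube) \<le> B * (\<integral>x. \<bar>partial_sum d n x\<bar> powr p \<partial>cube)"
      if "c \<le> B" for c using that by (intro mult_right_mono) auto
    show ?thesis
    proof (cases "p \<le> 2")
      case True
      show ?thesis
        by (rule order_trans[OF bound_low[OF True] mono]) (simp add: B_def)
    next
      case False
      then have "2 \<le> p" by simp
      show ?thesis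
        by (rule order_trans[OF bound_high[OF \<open>2 \<le> p\<close>] mono]) (simp add: B_def low_const_nonneg[OF assms])
    qed
  qed
  show ?thesis
  proof (intro exI[of _ "B powr (1 / p)"] conjI allI impI)
    show "B powr (1 / p) > 0" using B by simp
    fix d e :: "nat \<Rightarrow> (nat \<Rightarrow> real) \<Rightarrow> real" and n :: nat
    assume mds: "martingale_difference_seq cube coord_algebra d" "martingale_difference_seq cube coord_algebra e"
      and dom: "\<forall>k\<ge>1. \<forall>t\<in>{0..1}. AE x in cube.
        (\<integral>\<^sup>+ s\<in>{0<..<t}. ennreal (decr_rearrangement unit_measure (coord_section k (e k) x) s) \<partial>lborel)
        \<le> (\<integral>\<^sup>+ s\<in>{0<..<t}. ennreal (decr_rearrangement unit_measure (coord_section k (d k) x) s) \<partial>lborel)"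
    have [measurable]: "partial_sum d n \<in> borel_measurable cube" "partial_sum e n \<in> borel_measurable cube"
      using mds by (auto intro: partial_sum_measurable)
    have "Lp_norm p cube (partial_sum e n) \<le> ennreal (B powr (1 / p)) * Lp_norm p cube (partial_sum d n)"
    proof (cases "(\<integral>\<^sup>+ x. ennreal (\<bar>partial_sum d n x\<bar> powr p) \<partial>cube) = \<infinity>")
      case True
      then show ?thesis using B by (simp add: Lp_norm_def ennreal_mult_top)
    next
      case False
      then have int: "integrable cube (\<lambda>x. \<bar>partial_sum d n x\<bar> powr p)"
        by (simp add: integrable_iff_bounded less_top)
      have D: "dominated_mds p d e n"
        using assms mds dom int by unfold_locales auto
      interpret dominated_mds p d e n by (rule D)
      have norm: "Lp_norm p cube f = ennreal ((\<integral>x. \<bar>f x\<bar> powr p \<partial>cube) powr (1 / p))"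
        if "integrable cube (\<lambda>x. \<bar>f x\<bar> powr p)" for f
        using nn_integral_eq_integral[OF that] by (simp add: Lp_norm_def)
      have "(\<integral>x. \<bar>partial_sum e n x\<bar> powr p \<partial>cube) powr (1 / p)
          \<le> (B * (\<integral>x. \<bar>partial_sum d n x\<bar> powr p \<partial>cube)) powr (1 / p)"
        using assms by (intro powr_mono2 bound D) auto
      also have "\<dots> = B powr (1 / p) * (\<integral>x. \<bar>partial_sum d n x\<bar> powr p \<partial>cube) powr (1 / p)"
        using B by (simp add: powr_mult)
      finally show ?thesis
        unfolding norm[OF int] norm[OF Y_powr[OF order_refl]]
        by (simp add: ennreal_leI flip: ennreal_mult')
    qed
    then show "Lp_norm p cube (\<lambda>x. \<Sum>k=1..n. e k x) \<le> ennreal (B powr (1 / p)) * Lp_norm p cube (\<lambda>x. \<Sum>k=1..n. d k x)"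
      by (simp add: partial_sum_def[abs_def])
  qed
qed

end
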